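(* There exists a polynomial-time algorithm to solve \textsc{InvertibleSigning}: given a real symmetric matrix $M$, decide whether there exists a symmetric signing $s$ such that $M(s)$ is invertible.
   Context: For a real symmetric $n\times n$ matrix $M$, a signing is an $n\times n$ matrix $s$ with entries in $\{\pm1\}$; it is symmetric if $s$ is a symmetric matrix. The signed matrix $M(s)$ is the entry-wise product of $M$ and $s$. *)

theory Defs
  imports
    "Jordan_Normal_Form.Matrix"
    "HOL-Computational_Algebra.Polynomial"
    "HOL-Library.Discrete_Functions"
begin

section \<open>Symmetric signings\<close>

definition symmetric_mat :: "'a mat \<Rightarrow> bool" where
  "symmetric_mat A \<longleftrightarrow> square_mat A \<and> A\<^sup>T = A"

definition signing :: "nat \<Rightarrow> real mat \<Rightarrow> bool" where
  "signing n s \<longleftrightarrow> s \<in> carrier_mat n n \<and> (\<forall>i<n. \<forall>j<n. s $$ (i, j) \<in> {1, -1})"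

definition signed_mat :: "real mat \<Rightarrow> real mat \<Rightarrow> real mat" where
  "signed_mat M s = mat (dim_row M) (dim_col M) (\<lambda>(i, j). M $$ (i, j) * s $$ (i, j))"

definition invertible_signing :: "real mat \<Rightarrow> bool" where
  "invertible_signing M \<longleftrightarrow>
     (\<exists>s. signing (dim_row M) s \<and> symmetric_mat s \<and> invertible_mat (signed_mat M s))"

section \<open>Real random access machines\<close>

text \<open>
  The machine has two infinite memories, one with natural numbers (used for counting and for
  addressing) and one with real numbers. An address is either fixed in the program
  (\<open>Dir\<close>) or found in a cell of the memory of natural numbers (\<open>Ind\<close>). Programs
  contain only integer literals, and the two memories do not mix: a real number cannot be rounded
  or used as an address. Natural numbers can only be added and subtracted. With multiplication at
  unit cost, repeated squaring would produce numbers of exponential bit length in polynomially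
  many steps.
\<close>

datatype loc = Dir nat | Ind nat

datatype nat_operand = NLit nat | NCell loc

datatype real_operand = RLit int | RCell loc

datatype instr =
    NAdd loc nat_operand nat_operand
  | NSub loc nat_operand nat_operand
  | RAdd loc real_operand real_operand
  | RSub loc real_operand real_operand
  | RMul loc real_operand real_operand
  | RDiv loc real_operand real_operand

datatype test =
    NLess nat_operand nat_operand
  | NEq nat_operand nat_operand
  | RLess real_operand real_operand
  | REq real_operand real_operand

datatype prog =
    Skip
  | Do instr
  | Seq prog prog
  | Cond test prog prog
  | While test prog

record state =
  nmem :: "nat \<Rightarrow> nat"
  rmem :: "nat \<Rightarrow> real"

fun addr :: "loc \<Rightarrow> state \<Rightarrow> nat" where
  "addr (Dir i) \<sigma> = i"
| "addr (Ind i) \<sigma> = nmem \<sigma> i"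

fun nat_val :: "nat_operand \<Rightarrow> state \<Rightarrow> nat" where
  "nat_val (NLit k) \<sigma> = k"
| "nat_val (NCell l) \<sigma> = nmem \<sigma> (addr l \<sigma>)"

fun real_val :: "real_operand \<Rightarrow> state \<Rightarrow> real" where
  "real_val (RLit k) \<sigma> = real_of_int k"
| "real_val (RCell l) \<sigma> = rmem \<sigma> (addr l \<sigma>)"

definition nat_store :: "loc \<Rightarrow> nat \<Rightarrow> state \<Rightarrow> state" where
  "nat_store l v \<sigma> = \<sigma>\<lparr>nmem := (nmem \<sigma>)(addr l \<sigma> := v)\<rparr>"

definition real_store :: "loc \<Rightarrow> real \<Rightarrow> state \<Rightarrow> state" where
  "real_store l v \<sigma> = \<sigma>\<lparr>rmem := (rmem \<sigma>)(addr l \<sigma> := v)\<rparr>"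

text \<open>Subtraction of natural numbers is truncated at 0, and division by 0 yields 0.\<close>

fun exec_instr :: "instr \<Rightarrow> state \<Rightarrow> state" where
  "exec_instr (NAdd l a b) \<sigma> = nat_store l (nat_val a \<sigma> + nat_val b \<sigma>) \<sigma>"
| "exec_instr (NSub l a b) \<sigma> = nat_store l (nat_val a \<sigma> - nat_val b \<sigma>) \<sigma>"
| "exec_instr (RAdd l a b) \<sigma> = real_store l (real_val a \<sigma> + real_val b \<sigma>) \<sigma>"
| "exec_instr (RSub l a b) \<sigma> = real_store l (real_val a \<sigma> - real_val b \<sigma>) \<sigma>"
| "exec_instr (RMul l a b) \<sigma> = real_store l (real_val a \<sigma> * real_val b \<sigma>) \<sigma>"
| "exec_instr (RDiv l a b) \<sigma> = real_store l (real_val a \<sigma> / real_val b \<sigma>) \<sigma>"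

fun eval_test :: "test \<Rightarrow> state \<Rightarrow> bool" where
  "eval_test (NLess a b) \<sigma> \<longleftrightarrow> nat_val a \<sigma> < nat_val b \<sigma>"
| "eval_test (NEq a b) \<sigma> \<longleftrightarrow> nat_val a \<sigma> = nat_val b \<sigma>"
| "eval_test (RLess a b) \<sigma> \<longleftrightarrow> real_val a \<sigma> < real_val b \<sigma>"
| "eval_test (REq a b) \<sigma> \<longleftrightarrow> real_val a \<sigma> = real_val b \<sigma>"

text \<open>
  \<open>exec ic tc c \<sigma> t \<tau>\<close>: started in \<open>\<sigma>\<close>, the program \<open>c\<close> halts in
  \<open>\<tau>\<close> with total cost \<open>t\<close>, where \<open>ic\<close> and \<open>tc\<close> give the cost of a
  single instruction and of a single test in the current state.
\<close>

inductive exec ::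
  "(instr \<Rightarrow> state \<Rightarrow> nat) \<Rightarrow> (test \<Rightarrow> state \<Rightarrow> nat) \<Rightarrow> prog \<Rightarrow> state \<Rightarrow> nat \<Rightarrow> state \<Rightarrow> bool"
  for ic tc where
  Skip: "exec ic tc Skip \<sigma> 1 \<sigma>"
| Do: "exec ic tc (Do i) \<sigma> (ic i \<sigma>) (exec_instr i \<sigma>)"
| Seq: "exec ic tc c \<sigma> t \<sigma>' \<Longrightarrow> exec ic tc d \<sigma>' u \<tau> \<Longrightarrow> exec ic tc (Seq c d) \<sigma> (t + u) \<tau>"
| Cond_True: "eval_test b \<sigma> \<Longrightarrow> exec ic tc c \<sigma> t \<tau> \<Longrightarrow> exec ic tc (Cond b c d) \<sigma> (tc b \<sigma> + t) \<tau>"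
| Cond_False: "\<not> eval_test b \<sigma> \<Longrightarrow> exec ic tc d \<sigma> t \<tau> \<Longrightarrow> exec ic tc (Cond b c d) \<sigma> (tc b \<sigma> + t) \<tau>"
| While_False: "\<not> eval_test b \<sigma> \<Longrightarrow> exec ic tc (While b c) \<sigma> (tc b \<sigma>) \<sigma>"
| While_True: "eval_test b \<sigma> \<Longrightarrow> exec ic tc c \<sigma> t \<sigma>' \<Longrightarrow> exec ic tc (While b c) \<sigma>' u \<tau> \<Longrightarrow>
    exec ic tc (While b c) \<sigma> (tc b \<sigma> + t + u) \<tau>"

section \<open>Unit cost and bit cost\<close>

abbreviation exec_unit :: "prog \<Rightarrow> state \<Rightarrow> nat \<Rightarrow> state \<Rightarrow> bool" where
  "exec_unit \<equiv> exec (\<lambda>_ _. 1) (\<lambda>_ _. 1)"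

definition nat_bits :: "nat \<Rightarrow> nat" where
  "nat_bits n = Suc (floor_log n)"

text \<open>The bit length of a rational number in lowest terms; irrelevant for irrational arguments.\<close>

definition rat_bits :: "real \<Rightarrow> nat" where
  "rat_bits x = (let (a, b) = quotient_of (THE q. x = real_of_rat q)
                 in nat_bits (nat \<bar>a\<bar>) + nat_bits (nat b))"

text \<open>The logarithmic cost criterion: an access is charged with the lengths of all numbers involved,
  addresses included.\<close>

fun addr_bits :: "loc \<Rightarrow> state \<Rightarrow> nat" where
  "addr_bits (Dir i) \<sigma> = nat_bits i"
| "addr_bits (Ind i) \<sigma> = nat_bits i + nat_bits (nmem \<sigma> i)"

fun nat_operand_bits :: "nat_operand \<Rightarrow> state \<Rightarrow> nat" where
  "nat_operand_bits (NLit k) \<sigma> = nat_bits k"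
| "nat_operand_bits (NCell l) \<sigma> = addr_bits l \<sigma> + nat_bits (nat_val (NCell l) \<sigma>)"

fun real_operand_bits :: "real_operand \<Rightarrow> state \<Rightarrow> nat" where
  "real_operand_bits (RLit k) \<sigma> = rat_bits (real_of_int k)"
| "real_operand_bits (RCell l) \<sigma> = addr_bits l \<sigma> + rat_bits (real_val (RCell l) \<sigma>)"

fun instr_bits :: "instr \<Rightarrow> state \<Rightarrow> nat" where
  "instr_bits (NAdd l a b) \<sigma> = addr_bits l \<sigma> + nat_operand_bits a \<sigma> + nat_operand_bits b \<sigma>"
| "instr_bits (NSub l a b) \<sigma> = addr_bits l \<sigma> + nat_operand_bits a \<sigma> + nat_operand_bits b \<sigma>"
| "instr_bits (RAdd l a b) \<sigma> = addr_bits l \<sigma> + real_operand_bits a \<sigma> + real_operand_bits b \<sigma>"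
| "instr_bits (RSub l a b) \<sigma> = addr_bits l \<sigma> + real_operand_bits a \<sigma> + real_operand_bits b \<sigma>"
| "instr_bits (RMul l a b) \<sigma> = addr_bits l \<sigma> + real_operand_bits a \<sigma> + real_operand_bits b \<sigma>"
| "instr_bits (RDiv l a b) \<sigma> = addr_bits l \<sigma> + real_operand_bits a \<sigma> + real_operand_bits b \<sigma>"

fun test_bits :: "test \<Rightarrow> state \<Rightarrow> nat" where
  "test_bits (NLess a b) \<sigma> = nat_operand_bits a \<sigma> + nat_operand_bits b \<sigma>"
| "test_bits (NEq a b) \<sigma> = nat_operand_bits a \<sigma> + nat_operand_bits b \<sigma>"
| "test_bits (RLess a b) \<sigma> = real_operand_bits a \<sigma> + real_operand_bits b \<sigma>"
| "test_bits (REq a b) \<sigma> = real_operand_bits a \<sigma> + real_operand_bits b \<sigma>"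

abbreviation exec_bits :: "prog \<Rightarrow> state \<Rightarrow> nat \<Rightarrow> state \<Rightarrow> bool" where
  "exec_bits \<equiv> exec instr_bits test_bits"

section \<open>Polynomial-time decision of matrix problems\<close>

text \<open>An \<open>n \<times> n\<close> matrix is presented row by row in the real cells \<open>0, \<dots>, n\<^sup>2 - 1\<close>,
  with \<open>n\<close> in cell 0 of the other memory; all other cells are 0. The answer is expected in
  cell 0 of the memory of natural numbers.\<close>

definition input_state :: "real mat \<Rightarrow> state" where
  "input_state M =
     (let n = dim_row M in
      \<lparr>nmem = (\<lambda>_. 0)(0 := n),
       rmem = (\<lambda>k. if k < n * n then M $$ (k div n, k mod n) else 0)\<rparr>)"

definition answer :: "state \<Rightarrow> bool \<Rightarrow> bool" where
  "answer \<sigma> a \<longleftrightarrow> nmem \<sigma> 0 = (if a then 1 else 0)"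

definition mat_bits :: "real mat \<Rightarrow> nat" where
  "mat_bits M = (\<Sum>i<dim_row M. \<Sum>j<dim_col M. rat_bits (M $$ (i, j)))"

text \<open>
  For real input, time is the number of arithmetic operations, comparisons and memory accesses, as a
  function of the dimension. This alone would not give a polynomial-time algorithm in the sense of
  Turing machines for rational input, because iterated multiplication can produce numbers of
  exponential length; hence the second condition, on the bit cost as a function of the bit length of
  the input.
\<close>

definition poly_time_decides :: "prog \<Rightarrow> real mat set \<Rightarrow> (real mat \<Rightarrow> bool) \<Rightarrow> bool" where
  "poly_time_decides c I P \<longleftrightarrow>
     (\<exists>p :: nat poly. \<forall>M\<in>I. \<exists>t \<tau>.
        exec_unit c (input_state M) t \<tau> \<and> t \<le> poly p (dim_row M) \<and> answer \<tau> (P M)) \<and>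
     (\<exists>p :: nat poly. \<forall>M\<in>I. elements_mat M \<subseteq> \<rat> \<longrightarrow> (\<exists>t \<tau>.
        exec_bits c (input_state M) t \<tau> \<and> t \<le> poly p (mat_bits M) \<and> answer \<tau> (P M)))"

end

theory Submission
  imports Defs "Jordan_Normal_Form.Determinant"
begin

text \<open>A symmetric matrix has an invertible symmetric signing iff some permutation selects only nonzero
  entries. For the nontrivial direction, let \<open>q\<close> be such a permutation and average
  \<open>det (M(s)) \<cdot> \<Prod>\<^sub>i s(i, q i)\<close> over all symmetric signings \<open>s\<close>. The Leibniz terms that survive
  belong to the permutations that use every undirected edge with the same parity as \<open>q\<close>. They differ
  from \<open>q\<close> only in the orientation of cycles and in the way points on 2-cycles are paired; neither
  affects the sign of the term, because 2-cycles contribute squares. Hence nothing cancels and some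
  \<open>det (M(s))\<close> is nonzero.

  A perfect matching of rows and columns is found by an auction with integer prices: an unassigned row
  takes its cheapest neighbouring column, raises its price by 1 and displaces the previous owner. A row
  all of whose neighbours cost more than \<open>n\<close> yields a violation of Hall's condition. The program
  never computes with real numbers, it only compares them to 0, and an addition of natural numbers
  makes them at most one bit longer; so a polynomial number of steps has polynomial bit cost.\<close>

section \<open>Permutation terms of a symmetric matrix\<close>

text \<open>The Leibniz term of \<open>p\<close>. The index set \<open>S\<close> is arbitrary, so
  that a term can be split along subsets invariant under \<open>p\<close>.\<close>

definition perm_term :: "('a \<Rightarrow> 'a \<Rightarrow> real) \<Rightarrow> ('a \<Rightarrow> 'a) \<Rightarrow> 'a set \<Rightarrow> real" where
  "perm_term M p S = of_int (sign p) * (\<Prod>i\<in>S. M i (p i))"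

text \<open>\<open>p\<close> is the composition of its restrictions to \<open>A\<close> and to the
  complement, and the sign is multiplicative.\<close>

lemma perm_term_split:
  assumes "finite S" "p permutes S" "A \<subseteq> S" "p ` A = A"
  shows "perm_term M p S
    = perm_term M (restrict_id p A) A * perm_term M (restrict_id p (S - A)) (S - A)"
proof -
  have B: "p ` (S - A) = S - A"
    using assms by (simp add: image_set_diff permutes_inj permutes_image)
  have inj: "inj_on p C" for C
    using assms(2) permutes_inj_on by blast
  have pA: "restrict_id p A permutes A"
    by (rule permutes_restrict_id) (simp add: bij_betw_def inj assms(4))
  have pB: "restrict_id p (S - A) permutes S - A"
    by (rule permutes_restrict_id) (simp add: bij_betw_def inj B)
  have comp: "p = restrict_id p A \<circ> restrict_id p (S - A)"
    using B assms(3) permutes_not_in[OF assms(2)] by (auto simp: restrict_id_def fun_eq_iff)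
  have "sign p = sign (restrict_id p A) * sign (restrict_id p (S - A))"
    using sign_compose[of "restrict_id p A" "restrict_id p (S - A)"] pA pB assms(1,3) comp
    by (metis finite_Diff finite_subset permutes_imp_permutation)
  moreover have "(\<Prod>i\<in>S. M i (p i)) = (\<Prod>i\<in>A. M i (p i)) * (\<Prod>i\<in>S - A. M i (p i))"
    using prod.subset_diff[OF assms(3,1)] by (simp add: mult.commute)
  ultimately show ?thesis
    by (simp add: perm_term_def restrict_id_def)
qed

text \<open>Reindexing the product by \<open>p\<close> transposes every entry, and inverse
  permutations have equal signs.\<close>

lemma perm_term_inv:
  assumes "finite S" "p permutes S" "\<And>i j. i \<in> S \<Longrightarrow> j \<in> S \<Longrightarrow> M i j = M j i"
  shows "perm_term M (Hilbert_Choice.inv p) S = perm_term M p S"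
proof -
  have "(\<Prod>i\<in>S. M i (Hilbert_Choice.inv p i)) = (\<Prod>i\<in>S. M (p i) (Hilbert_Choice.inv p (p i)))"
    using prod.permute[OF assms(2), of "\<lambda>i. M i (Hilbert_Choice.inv p i)"] by (simp add: o_def)
  also have "\<dots> = (\<Prod>i\<in>S. M i (p i))"
    by (intro prod.cong refl)
      (simp add: permutes_inverses(2)[OF assms(2)] permutes_in_image[OF assms(2)] assms(3))
  finally show ?thesis
    using assms(1,2) by (auto simp: perm_term_def intro!: sign_inverse permutes_imp_permutation)
qed

text \<open>Each 2-cycle on \<open>a\<close> and \<open>b\<close> contributes the factor
  \<open>- (M a b)\<^sup>2\<close>, so the sign depends only on the number of 2-cycles and not on
  the pairing. The induction removes one 2-cycle at a time.\<close>

lemma perm_term_involution: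
  assumes "finite S" "p permutes S" "\<And>i. i \<in> S \<Longrightarrow> p i \<noteq> i \<and> p (p i) = i"
    and "\<And>i j. i \<in> S \<Longrightarrow> j \<in> S \<Longrightarrow> M i j = M j i"
  shows "(- 1) ^ (card S div 2) * perm_term M p S \<ge> 0"
  using assms
proof (induction "card S" arbitrary: S p rule: less_induct)
  case less
  show ?case
  proof (cases "S = {}")
    case True
    then show ?thesis using less.prems by (simp add: perm_term_def)
  next
    case False
    then obtain a where a: "a \<in> S" by blast
    define b where "b = p a"
    have b: "b \<in> S" "b \<noteq> a" "p b = a"
      using a less.prems(2,3) permutes_in_image by (fastforce simp: b_def)+
    define T where "T = S - {a, b}"
    \<comment> \<open>This composition fixes both \<open>a\<close> and \<open>b\<close>, agrees with
      \<open>p\<close> elsewhere and has the opposite sign.\<close>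
    define q where "q = transpose a b \<circ> p"
    have S: "S = insert a (insert b T)" and fT: "finite T" "a \<notin> insert b T" "b \<notin> T"
      using a b less.prems(1) by (auto simp: T_def)
    have nT: "p i \<in> T" if "i \<in> T" for i
      using that less.prems(2,3) permutes_in_image[OF less.prems(2)] b
      by (metis S b_def fT(2,3) insertE insert_iff)
    have qT: "q i = p i" if "i \<in> T" for i
      using nT[OF that] fT by (auto simp: q_def transpose_def)
    have q: "q permutes T"
    proof (rule permutes_superset)
      show "q permutes S"
        unfolding q_def using less.prems(2) a b permutes_compose permutes_swap_id by metis
      show "q x = x" if "x \<in> S - T" for x
        using that S b b_def by (auto simp: q_def)
    qed
    have "sign q = - sign p"
      unfolding q_def using b less.prems(1,2)
      by (subst sign_compose) (auto simp: sign_swap_id permutation_swap_id permutes_imp_permutation)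
    moreover have "(\<Prod>i\<in>S. M i (p i)) = M a b * M b a * (\<Prod>i\<in>T. M i (q i))"
      unfolding S using fT b qT by (simp add: b_def[symmetric])
    moreover have "M b a = M a b"
      using a b less.prems(4) by blast
    ultimately have "perm_term M p S = - (M a b)\<^sup>2 * perm_term M q T"
      by (simp add: perm_term_def power2_eq_square)
    moreover have "card S = Suc (Suc (card T))"
      unfolding S using fT by simp
    moreover have "(- 1) ^ (card T div 2) * perm_term M q T \<ge> 0"
    proof (rule less.hyps)
      show "card T < card S" by (simp add: calculation(2))
      show "q i \<noteq> i \<and> q (q i) = i" if "i \<in> T" for i
        using that qT nT less.prems(3) S by simp
      show "M i j = M j i" if "i \<in> T" "j \<in> T" for i j
        using that less.prems(4) S by simp
    qed (use q fT in auto)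
    ultimately show ?thesis
      using mult_nonneg_nonneg[of "(M a b)\<^sup>2" "(- 1) ^ (card T div 2) * perm_term M q T"]
      by (simp add: mult.left_commute)
  qed
qed

text \<open>The hypotheses say that \<open>p\<close> and \<open>q\<close> use every edge \<open>{i, j}\<close> with the same parity. Then
  they have the same loops and the same undirected cycles of length at least 3, each of which may be
  traversed in either direction, while the points on 2-cycles may be paired up differently.\<close>

lemma perm_term_same_parity:
  assumes "finite S" "p permutes S" "q permutes S"
    and sym: "\<And>i j. i \<in> S \<Longrightarrow> j \<in> S \<Longrightarrow> M i j = M j i"
    and loops: "\<And>i. i \<in> S \<Longrightarrow> p i = i \<longleftrightarrow> q i = i"
    and edges: "\<And>i j. i \<in> S \<Longrightarrow> j \<in> S \<Longrightarrow> i \<noteq> j \<Longrightarrow>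
      (p i = j) \<noteq> (p j = i) \<longleftrightarrow> (q i = j) \<noteq> (q j = i)"
  shows "perm_term M p S * perm_term M q S \<ge> 0"
proof -
  have pS: "p i \<in> S \<longleftrightarrow> i \<in> S" and qS: "q i \<in> S \<longleftrightarrow> i \<in> S" for i
    using assms(2,3) permutes_in_image by metis+
  have pinj: "p i = p j \<longleftrightarrow> i = j" and qinj: "q i = q j \<longleftrightarrow> i = j" for i j
    using assms(2,3) permutes_inj by (metis injD)+
  have inj: "inj_on p C" "inj_on q C" for C
    by (simp_all add: inj_on_def pinj qinj)
  have invariant: "f ` C = C" if "\<And>i. i \<in> C \<Longrightarrow> f i \<in> C" "C \<subseteq> S" "f = p \<or> f = q" for f C
    using that inj \<open>finite S\<close> by (intro endo_inj_surj) (auto intro: finite_subset)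
  \<comment> \<open>Such an \<open>i\<close> lies on a cycle of \<open>p\<close> of length at least
    3, so its edge to \<open>p i\<close> has odd parity and \<open>q\<close> uses it exactly once,
    in one of the two directions.\<close>
  have pq: "(q i = p i \<or> q (p i) = i) \<and> q (q i) \<noteq> i" if "i \<in> S" "p (p i) \<noteq> i" for i
    using edges[of i "p i"] that pS qinj by metis
  have qp: "p (p i) \<noteq> i" if "i \<in> S" "q (q i) \<noteq> i" for i
    using edges[of i "q i"] that qS pinj by metis
  \<comment> \<open>Both permutations leave three sets invariant: \<open>U\<close>, the points on
    2-cycles; \<open>X\<close>, the loops and the longer cycles with the same direction in both;
    \<open>Y\<close>, the longer cycles with opposite directions.\<close>
  define U where "U = {i \<in> S. p i \<noteq> i \<and> p (p i) = i}"
  have Uq: "U = {i \<in> S. q i \<noteq> i \<and> q (q i) = i}"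
    unfolding U_def using pq qp loops by blast
  define X where "X = {i \<in> S - U. p i = q i}"
  define Y where "Y = S - U - X"
  have XS: "X \<subseteq> S - U" by (auto simp: X_def)
  have pU: "p ` U = U"
    by (rule invariant) (use pS in \<open>auto simp: U_def\<close>)
  have qU: "q ` U = U"
    by (rule invariant) (use qS in \<open>auto simp: Uq\<close>)
  have Xp: "p i \<in> X" if "i \<in> X" for i
  proof (cases "p i = i")
    case False
    then have i: "i \<in> S" "p (p i) \<noteq> i" "q i = p i"
      using that by (auto simp: X_def U_def)
    \<comment> \<open>If \<open>q\<close> used the next edge backwards, it would send both
      \<open>i\<close> and \<open>p (p i)\<close> to \<open>p i\<close>.\<close>
    have "q (p i) = p (p i)"
      using edges[of "p i" "p (p i)"] i False pS pinj qinj by metis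
    then show ?thesis
      using i pS pinj by (auto simp: X_def U_def)
  qed (use that in simp)
  have pX: "p ` X = X"
    by (rule invariant) (use Xp XS in auto)
  have qX: "q ` X = X"
    by (rule invariant) (use Xp XS in \<open>auto simp: X_def\<close>)
  have pY: "p ` Y = Y"
    using pU pX assms(2) XS by (simp add: Y_def image_set_diff permutes_inj permutes_image)
  have qY: "q ` Y = Y"
    using qU qX assms(3) XS by (simp add: Y_def image_set_diff permutes_inj permutes_image)
  have qpY: "q (p i) = i" if "i \<in> Y" for i
    using that pq[of i] loops by (auto simp: Y_def X_def U_def)
  let ?t = "\<lambda>f A. perm_term M (restrict_id f A) A"
  have split: "perm_term M f S = ?t f U * (?t f X * ?t f Y)"
    if f: "f permutes S" "f ` U = U" "f ` X = X" for f
  proof -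
    have S1: "f ` (S - U) = S - U"
      using f U_def by (simp add: image_set_diff permutes_inj permutes_image)
    then have "restrict_id f (S - U) permutes S - U"
      using f by (intro permutes_restrict_id) (simp add: bij_betw_def permutes_inj_on)
    moreover have "restrict_id f (S - U) ` X = X"
      using XS by (subst f(3)[symmetric], intro image_cong) (auto simp: restrict_id_def)
    ultimately have "?t f (S - U) = perm_term M (restrict_id (restrict_id f (S - U)) X) X
        * perm_term M (restrict_id (restrict_id f (S - U)) (S - U - X)) (S - U - X)"
      using XS \<open>finite S\<close> by (intro perm_term_split) auto
    moreover have "restrict_id (restrict_id f (S - U)) C = restrict_id f C" if "C \<subseteq> S - U" for C
      using that by (auto simp: restrict_id_def fun_eq_iff)
    ultimately have "?t f (S - U) = ?t f X * ?t f Y"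
      using XS by (simp add: Y_def)
    then show ?thesis
      using perm_term_split[OF \<open>finite S\<close> f(1) _ f(2), of M] by (simp add: U_def)
  qed
  have perm: "restrict_id f C permutes C" if "f = p \<or> f = q" "f ` C = C" for f C
    using that by (intro permutes_restrict_id) (auto simp: bij_betw_def inj)
  have finU: "finite U" and finY: "finite Y" and US: "U \<subseteq> S" and YS: "Y \<subseteq> S"
    using \<open>finite S\<close> by (auto simp: U_def Y_def)
  have invol: "(- 1) ^ (card U div 2) * ?t f U \<ge> 0" if "f = p \<or> f = q" for f
  proof (rule perm_term_involution[OF finU])
    show "restrict_id f U permutes U"
      using that perm pU qU by auto
    show "restrict_id f U i \<noteq> i \<and> restrict_id f U (restrict_id f U i) = i" if "i \<in> U" for i
    proof -
      have "f i \<noteq> i \<and> f (f i) = i" "f i \<in> U"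
        using \<open>i \<in> U\<close> \<open>f = p \<or> f = q\<close> pU qU U_def Uq by blast+
      then show ?thesis using that by (simp add: restrict_id_def)
    qed
    show "M i j = M j i" if "i \<in> U" "j \<in> U" for i j
      using that US sym by blast
  qed
  have U: "?t p U * ?t q U \<ge> 0"
    using mult_nonneg_nonneg[OF invol[of p] invol[of q]]
    by (cases "even (card U div 2)") simp_all
  have "restrict_id q X = restrict_id p X"
    by (auto simp: restrict_id_def X_def fun_eq_iff)
  then have X: "?t p X * ?t q X \<ge> 0" by simp
  \<comment> \<open>On \<open>Y\<close> the cycles are reversed, and reversal does not change the
    term of a symmetric matrix.\<close>
  have "Hilbert_Choice.inv (restrict_id p Y) = restrict_id q Y"
  proof (rule inv_equality)
    have pYi: "p i \<in> Y" "q i \<in> Y" if "i \<in> Y" for i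
      using that pY qY by blast+
    show "restrict_id q Y (restrict_id p Y i) = i" for i
      using qpY pYi by (auto simp: restrict_id_def)
    show "restrict_id p Y (restrict_id q Y i) = i" for i
      using qpY[OF pYi(2)] pYi qinj by (auto simp: restrict_id_def)
  qed
  then have "?t q Y = ?t p Y"
    using perm_term_inv[OF finY perm[OF _ pY], of M] sym YS by (auto simp: subset_iff)
  then have Y: "?t p Y * ?t q Y \<ge> 0" by simp
  have "perm_term M p S * perm_term M q S
      = (?t p U * ?t q U) * ((?t p X * ?t q X) * (?t p Y * ?t q Y))"
    using split[OF assms(2) pU pX] split[OF assms(3) qU qX] by (simp add: mult_ac)
  also have "\<dots> \<ge> 0"
    by (rule mult_nonneg_nonneg[OF U mult_nonneg_nonneg[OF X Y]])
  finally show ?thesis .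
qed

section \<open>Averaging over symmetric signings\<close>

text \<open>Indexing by sets of unordered pairs makes the signing symmetric by construction; the
  singleton \<open>{i}\<close> stands for a diagonal entry.\<close>

definition flip_signs :: "nat \<Rightarrow> nat set set \<Rightarrow> real mat" where
  "flip_signs n F = mat n n (\<lambda>(i, j). if {i, j} \<in> F then - 1 else 1)"

lemma flip_signs_symmetric_signing:
  "signing n (flip_signs n F)" "symmetric_mat (flip_signs n F)"
  by (auto simp: signing_def symmetric_mat_def flip_signs_def insert_commute intro!: eq_matI)

section \<open>Parity of the use of edges by a permutation\<close>

definition edge_count :: "nat \<Rightarrow> (nat \<Rightarrow> nat) \<Rightarrow> nat set \<Rightarrow> nat" where
  "edge_count n p e = card {i \<in> {0..<n}. {i, p i} = e}"

lemma odd_edge_count_loop: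
  assumes "a < n"
  shows "odd (edge_count n p {a}) \<longleftrightarrow> p a = a"
proof -
  have "{i \<in> {0..<n}. {i, p i} = {a}} = (if p a = a then {a} else {})"
    using assms by auto
  then show ?thesis by (simp add: edge_count_def)
qed

lemma odd_edge_count_edge:
  assumes "a < n" "b < n" "a \<noteq> b"
  shows "odd (edge_count n p {a, b}) \<longleftrightarrow> (p a = b) \<noteq> (p b = a)"
proof -
  have "{i \<in> {0..<n}. {i, p i} = {a, b}}
      = (if p a = b then {a} else {}) \<union> (if p b = a then {b} else {})"
    using assms by (auto simp: doubleton_eq_iff)
  then show ?thesis using assms(3) by (simp add: edge_count_def)
qed

definition all_edges :: "nat \<Rightarrow> nat set set" where
  "all_edges n = (\<lambda>(i, j). {i, j}) ` ({0..<n} \<times> {0..<n})"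

lemma finite_all_edges [simp]: "finite (all_edges n)"
  by (simp add: all_edges_def)

text \<open>The rows are grouped by the edge that \<open>p\<close> uses in them; a flipped edge
  contributes one factor \<open>- 1\<close> per use.\<close>

lemma prod_flip_signs:
  assumes "p permutes {0..<n}"
  shows "(\<Prod>i=0..<n. flip_signs n F $$ (i, p i))
    = (\<Prod>e\<in>all_edges n. if e \<in> F then (- 1) ^ edge_count n p e else 1)"
proof -
  have p: "p i < n" if "i < n" for i
    using permutes_in_image[OF assms, of i] that by simp
  have "(\<Prod>i=0..<n. flip_signs n F $$ (i, p i)) = (\<Prod>i=0..<n. if {i, p i} \<in> F then - 1 else 1)"
    by (intro prod.cong refl) (simp add: flip_signs_def p)
  also have "\<dots> = (\<Prod>e\<in>all_edges n. \<Prod>i\<in>{i \<in> {0..<n}. {i, p i} = e}. if {i, p i} \<in> F then - 1 else 1)"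
    by (rule prod.group[symmetric]) (auto simp: all_edges_def p)
  also have "\<dots> = (\<Prod>e\<in>all_edges n. if e \<in> F then (- 1) ^ edge_count n p e else 1)"
    by (intro prod.cong refl) (simp add: edge_count_def)
  finally show ?thesis .
qed

text \<open>Expanding the right-hand side picks \<open>x e\<close> or 1 from each factor;
  \<open>F\<close> collects the indices where \<open>x e\<close> is picked.\<close>

lemma sum_Pow_prod_if:
  fixes x :: "'a \<Rightarrow> real"
  assumes "finite A"
  shows "(\<Sum>F\<in>Pow A. \<Prod>e\<in>A. if e \<in> F then x e else 1) = (\<Prod>e\<in>A. x e + 1)"
proof -
  have "(\<Prod>e\<in>A. if e \<in> F then x e else 1) = prod x F * (\<Prod>e\<in>A - F. 1)" if "F \<in> Pow A" for F
  proof -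
    have "A \<inter> {e. e \<in> F} = F" using that by auto
    then show ?thesis using assms by (simp add: prod.If_cases)
  qed
  then show ?thesis by (simp add: prod_add[OF assms])
qed

text \<open>An orthogonality relation: an edge contributes 2 if \<open>p\<close> and
  \<open>q\<close> use it with the same parity and 0 otherwise.\<close>

lemma sum_flip_signs:
  assumes p: "p permutes {0..<n}" and q: "q permutes {0..<n}"
  shows "(\<Sum>F\<in>Pow (all_edges n).
      (\<Prod>i=0..<n. flip_signs n F $$ (i, q i)) * (\<Prod>i=0..<n. flip_signs n F $$ (i, p i)))
    = (\<Prod>e\<in>all_edges n. (- 1) ^ (edge_count n q e + edge_count n p e) + 1)"
  unfolding prod_flip_signs[OF p] prod_flip_signs[OF q]
    sum_Pow_prod_if[OF finite_all_edges, symmetric] prod.distrib[symmetric]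
  by (intro sum.cong prod.cong refl) (simp add: power_add)

section \<open>Determinants of signed matrices and invertibility\<close>

lemma det_signed_mat:
  assumes "M \<in> carrier_mat n n"
  shows "det (signed_mat M s) = (\<Sum>p | p permutes {0..<n}.
    perm_term (\<lambda>i j. M $$ (i, j)) p {0..<n} * (\<Prod>i=0..<n. s $$ (i, p i)))"
proof -
  have "(\<Prod>i=0..<n. signed_mat M s $$ (i, p i)) = (\<Prod>i=0..<n. M $$ (i, p i)) * (\<Prod>i=0..<n. s $$ (i, p i))"
    if "p permutes {0..<n}" for p
    unfolding prod.distrib[symmetric]
    by (intro prod.cong refl) (use assms permutes_in_image[OF that] in \<open>auto simp: signed_mat_def\<close>)
  moreover have "signed_mat M s \<in> carrier_mat n n"
    using assms by (simp add: signed_mat_def)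
  ultimately show ?thesis
    by (auto simp: det_def' perm_term_def mult.assoc intro!: sum.cong)
qed

lemma invertible_mat_iff_det:
  fixes A :: "'a :: field mat"
  assumes "A \<in> carrier_mat n n"
  shows "invertible_mat A \<longleftrightarrow> det A \<noteq> 0"
proof
  assume "invertible_mat A"
  then obtain B where B: "A * B = 1\<^sub>m n" "B * A = 1\<^sub>m (dim_row B)"
    using assms by (auto simp: invertible_mat_def inverts_mat_def)
  \<comment> \<open>The dimensions of \<open>B\<close> are read off from the two products, which are
    identity matrices.\<close>
  have "dim_col (A * B) = n" "dim_col (B * A) = dim_row B"
    unfolding B by simp_all
  then have "dim_col B = n" "dim_row B = n"
    using assms by simp_all
  then have "B \<in> carrier_mat n n" by auto
  from det_mult[OF assms this] have "det A * det B = 1"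
    unfolding B(1) by simp
  then show "det A \<noteq> 0" by auto
next
  assume "det A \<noteq> 0"
  from det_non_zero_imp_unit[OF assms this]
  obtain B where "B \<in> carrier_mat n n" "B * A = 1\<^sub>m n" "A * B = 1\<^sub>m n"
    by (auto simp: Units_def ring_mat_def)
  then show "invertible_mat A"
    using assms by (auto simp: invertible_mat_def inverts_mat_def)
qed

theorem invertible_signing_iff_permutation:
  assumes "symmetric_mat M" and n: "n = dim_row M"
  shows "invertible_signing M \<longleftrightarrow> (\<exists>q. q permutes {0..<n} \<and> (\<forall>i<n. M $$ (i, q i) \<noteq> 0))"
proof
  have M: "M \<in> carrier_mat n n"
    using assms by (auto simp: symmetric_mat_def)
  have sM: "signed_mat M s \<in> carrier_mat n n" for s
    using M by (simp add: signed_mat_def)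
  let ?t = "\<lambda>p. perm_term (\<lambda>i j. M $$ (i, j)) p {0..<n}"
  {
    assume "invertible_signing M"
    then obtain s where "det (signed_mat M s) \<noteq> 0"
      using invertible_mat_iff_det[OF sM] by (auto simp: invertible_signing_def)
    then obtain q where "q permutes {0..<n}" "?t q \<noteq> 0"
      unfolding det_signed_mat[OF M] by (metis (no_types, lifting) mem_Collect_eq mult_zero_left sum.neutral)
    then show "\<exists>q. q permutes {0..<n} \<and> (\<forall>i<n. M $$ (i, q i) \<noteq> 0)"
      by (auto simp: perm_term_def)
  next
    assume "\<exists>q. q permutes {0..<n} \<and> (\<forall>i<n. M $$ (i, q i) \<noteq> 0)"
    then obtain q where q: "q permutes {0..<n}" and nz: "\<forall>i<n. M $$ (i, q i) \<noteq> 0" by blast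
    have tq: "?t q \<noteq> 0" using nz by (simp add: perm_term_def)
    let ?d = "\<lambda>F. det (signed_mat M (flip_signs n F))"
    let ?c = "\<lambda>p. (\<Prod>e\<in>all_edges n. (- 1) ^ (edge_count n q e + edge_count n p e) + 1 :: real)"
    have sym: "M $$ (i, j) = M $$ (j, i)" if "i < n" "j < n" for i j
      using assms(1) M that by (metis carrier_matD index_transpose_mat(1) symmetric_mat_def)
    \<comment> \<open>Every permutation that survives the averaging has a term of the same sign as
      that of \<open>q\<close>, or a zero term.\<close>
    have nonneg: "?t q * (?t p * ?c p) \<ge> 0" if p: "p permutes {0..<n}" for p
    proof (cases "?c p = 0")
      case False
      have parity: "odd (edge_count n p {i, j}) \<longleftrightarrow> odd (edge_count n q {i, j})" if "i < n" "j < n" for i j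
      proof -
        have "{i, j} \<in> all_edges n"
          using that by (auto simp: all_edges_def)
        then have "(- 1 :: real) ^ (edge_count n q {i, j} + edge_count n p {i, j}) + 1 \<noteq> 0"
          using False unfolding prod_zero_iff[OF finite_all_edges] by blast
        then show ?thesis
          by (cases "even (edge_count n q {i, j} + edge_count n p {i, j})") auto
      qed
      have "?t p * ?t q \<ge> 0"
      proof (rule perm_term_same_parity[OF _ p q])
        show "p i = i \<longleftrightarrow> q i = i" if "i \<in> {0..<n}" for i
          using parity[of i i] odd_edge_count_loop[of i n] that by simp
        show "(p i = j) \<noteq> (p j = i) \<longleftrightarrow> (q i = j) \<noteq> (q j = i)"
          if "i \<in> {0..<n}" "j \<in> {0..<n}" "i \<noteq> j" for i j
          using parity[of i j] odd_edge_count_edge[of i n j] that by simp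
      qed (use sym in auto)
      moreover have "?c p \<ge> 0"
      proof (rule prod_nonneg)
        show "0 \<le> (- 1 :: real) ^ (edge_count n q e + edge_count n p e) + 1" for e
          by (cases "even (edge_count n q e + edge_count n p e)") auto
      qed
      ultimately have "(?t p * ?t q) * ?c p \<ge> 0"
        by (rule mult_nonneg_nonneg)
      then show ?thesis by (simp add: mult_ac)
    next
      case True
      show ?thesis unfolding True by simp
    qed
    have "(\<Sum>F\<in>Pow (all_edges n). (\<Prod>i=0..<n. flip_signs n F $$ (i, q i)) * ?d F)
        = (\<Sum>F\<in>Pow (all_edges n). \<Sum>p | p permutes {0..<n}. ?t p *
            ((\<Prod>i=0..<n. flip_signs n F $$ (i, q i)) * (\<Prod>i=0..<n. flip_signs n F $$ (i, p i))))"
      unfolding det_signed_mat[OF M] sum_distrib_left by (intro sum.cong refl) (simp only: mult_ac)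
    also have "\<dots> = (\<Sum>p | p permutes {0..<n}. ?t p * (\<Sum>F\<in>Pow (all_edges n).
            (\<Prod>i=0..<n. flip_signs n F $$ (i, q i)) * (\<Prod>i=0..<n. flip_signs n F $$ (i, p i))))"
      by (subst sum.swap) (simp add: sum_distrib_left)
    also have "\<dots> = (\<Sum>p | p permutes {0..<n}. ?t p * ?c p)"
      by (intro sum.cong refl) (simp add: sum_flip_signs q)
    finally have avg: "(\<Sum>F\<in>Pow (all_edges n). (\<Prod>i=0..<n. flip_signs n F $$ (i, q i)) * ?d F)
        = (\<Sum>p | p permutes {0..<n}. ?t p * ?c p)" .
    \<comment> \<open>The exponents are even for \<open>p = q\<close>, so each factor is 2: the term
      of \<open>q\<close> survives and no other term can cancel it.\<close>
    have "?c q > 0"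
      by (rule prod_pos) simp
    moreover have "?t q * ?t q > 0"
      using tq not_real_square_gt_zero by blast
    ultimately have "0 < ?t q * (?t q * ?c q)"
      using mult_pos_pos[of "?t q * ?t q" "?c q"] by (simp only: mult.assoc)
    also have "\<dots> \<le> (\<Sum>p | p permutes {0..<n}. ?t q * (?t p * ?c p))"
      using nonneg q by (intro member_le_sum) (auto simp: finite_permutations)
    finally have "(\<Sum>p | p permutes {0..<n}. ?t p * ?c p) \<noteq> 0"
      unfolding sum_distrib_left[symmetric] by (metis less_irrefl mult_zero_right)
    then have "\<exists>F. ?d F \<noteq> 0"
      unfolding avg[symmetric] by (rule contrapos_np) simp
    then show "invertible_signing M"
      unfolding invertible_signing_def using invertible_mat_iff_det[OF sM] flip_signs_symmetric_signing n
      by blast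
  }
qed

section \<open>Perfect matchings by auction\<close>

text \<open>\<open>p\<close> gives the prices of the columns, \<open>m\<close> their owners, and \<open>A\<close> is the set of rows that own a
  column. The second conjunct is the complementary slackness condition of the auction algorithm: no
  row could have had a column that is cheaper by more than 1.\<close>

definition auction :: "(nat \<Rightarrow> nat \<Rightarrow> bool) \<Rightarrow> nat \<Rightarrow> (nat \<Rightarrow> nat) \<Rightarrow> (nat \<Rightarrow> nat option) \<Rightarrow> nat set \<Rightarrow> bool" where
  "auction E n p m A \<longleftrightarrow>
     (\<forall>j<n. m j = None \<longrightarrow> p j = 0) \<and>
     (\<forall>j<n. \<forall>i. m j = Some i \<longrightarrow> E i j \<and> (\<forall>k<n. E i k \<longrightarrow> p j \<le> Suc (p k))) \<and>
     (\<forall>j<n. \<forall>k<n. \<forall>i. m j = Some i \<longrightarrow> m k = Some i \<longrightarrow> j = k) \<and>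
     A = {i. \<exists>j<n. m j = Some i}"

lemma auction_init: "auction E n (\<lambda>_. 0) (\<lambda>_. None) {}"
  by (simp add: auction_def)

lemma auction_cong:
  assumes "auction E n p m A" "\<And>j. j < n \<Longrightarrow> p' j = p j" "\<And>j. j < n \<Longrightarrow> m' j = m j" "A' = A"
  shows "auction E n p' m' A'"
  using assms unfolding auction_def by auto

text \<open>The price of a cheapest column rises by 1, which is just the slack granted to its new
  owner. For the owners of other columns the raise only weakens the slackness inequality.\<close>

lemma auction_bid:
  assumes auc: "auction E n p m A" and "i \<notin> A" "j < n" "E i j"
    and cheapest: "\<And>k. k < n \<Longrightarrow> E i k \<Longrightarrow> p j \<le> p k"
  shows "auction E n (p(j := Suc (p j))) (m(j := Some i)) (insert i A - set_option (m j))"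
proof -
  have new: "m k \<noteq> Some i" if "k < n" for k
    using auc that \<open>i \<notin> A\<close> by (auto simp: auction_def)
  have "insert i A - set_option (m j) = {i'. \<exists>k<n. (m(j := Some i)) k = Some i'}"
  proof (intro equalityI subsetI)
    fix x assume "x \<in> insert i A - set_option (m j)"
    then show "x \<in> {i'. \<exists>k<n. (m(j := Some i)) k = Some i'}"
      using auc \<open>j < n\<close> by (auto simp: auction_def)
  next
    fix x assume "x \<in> {i'. \<exists>k<n. (m(j := Some i)) k = Some i'}"
    then obtain k where k: "k < n" "(m(j := Some i)) k = Some x" by blast
    show "x \<in> insert i A - set_option (m j)"
    proof (cases "k = j")
      case True
      then show ?thesis using k new[OF \<open>j < n\<close>] by (auto simp: elem_set)
    next
      case False
      then have "m k = Some x" using k by simp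
      moreover have "m j \<noteq> Some x"
        using auc k(1) \<open>j < n\<close> \<open>m k = Some x\<close> False by (auto simp: auction_def)
      ultimately show ?thesis
        using auc k(1) by (auto simp: auction_def elem_set)
    qed
  qed
  moreover have "E x k \<and> (\<forall>l<n. E x l \<longrightarrow> (p(j := Suc (p j))) k \<le> Suc ((p(j := Suc (p j))) l))"
    if k: "k < n" "(m(j := Some i)) k = Some x" for k x
  proof (cases "k = j")
    case True
    then show ?thesis using k \<open>E i j\<close> cheapest by auto
  next
    case False
    then have "E x k \<and> (\<forall>l<n. E x l \<longrightarrow> p k \<le> Suc (p l))"
      using auc k by (auto simp: auction_def)
    then show ?thesis using False \<open>j < n\<close> by (auto intro: le_SucI)
  qed
  moreover have "k = l" if "k < n" "l < n" "(m(j := Some i)) k = Some x" "(m(j := Some i)) l = Some x" for k l x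
    using that new auc by (auto simp: auction_def split: if_splits)
  moreover have "(p(j := Suc (p j))) k = 0" if "k < n" "(m(j := Some i)) k = None" for k
    using that auc by (auto simp: auction_def split: if_splits)
  ultimately show ?thesis
    unfolding auction_def by blast
qed

text \<open>Among the \<open>n + 1\<close> levels \<open>0, \<dots>, n\<close> one is not the price of any column. The rows assigned
  to columns above this gap have no neighbours below it, and neither has \<open>i\<close>: together they violate
  Hall's condition.\<close>

lemma auction_stuck:
  assumes auc: "auction E n p m A" and i: "i \<notin> A" "i < n" and A: "A \<subseteq> {..<n}"
    and high: "\<And>k. k < n \<Longrightarrow> E i k \<Longrightarrow> n < p k"
    and q: "q permutes {0..<n}" "\<forall>i<n. E i (q i)"
  shows False
proof -
  have "card (p ` {..<n}) \<le> n"
    using card_image_le[of "{..<n}" p] by simp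
  then have "\<not> {..n} \<subseteq> p ` {..<n}"
    using card_mono[of "p ` {..<n}" "{..n}"] by auto
  then obtain g where g: "g \<le> n" "\<And>j. j < n \<Longrightarrow> p j \<noteq> g"
    by auto
  define T where "T = {j. j < n \<and> g < p j}"
  define S where "S = insert i ((\<lambda>j. the (m j)) ` T)"
  \<comment> \<open>Columns above the gap have positive prices, hence owners.\<close>
  have m: "\<exists>x. m j = Some x" if "j \<in> T" for j
    using that auc by (cases "m j") (auto simp: auction_def T_def)
  have "inj_on (\<lambda>j. the (m j)) T"
  proof (rule inj_onI)
    fix j k assume "j \<in> T" "k \<in> T" "the (m j) = the (m k)"
    then show "j = k" using m[of j] m[of k] auc by (auto simp: auction_def T_def)
  qed
  moreover have "(\<lambda>j. the (m j)) ` T \<subseteq> A"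
  proof
    fix x assume "x \<in> (\<lambda>j. the (m j)) ` T"
    then obtain j where "j \<in> T" "x = the (m j)" by blast
    then have "j < n" "m j = Some x" using m by (force simp: T_def)+
    then show "x \<in> A" using auc by (auto simp: auction_def)
  qed
  moreover have finT: "finite T" by (simp add: T_def)
  ultimately have SA: "S \<subseteq> insert i A" and card: "card S = Suc (card T)"
    using i by (auto simp: S_def card_image card_insert_if)
  \<comment> \<open>\<open>S\<close> has one element more than \<open>T\<close>, so it suffices that
    the injective \<open>q\<close> maps \<open>S\<close> into \<open>T\<close>.\<close>
  have "q x \<in> T" if xS: "x \<in> S" for x
  proof -
    have "x < n" using xS SA i A by auto
    then have qx: "q x < n" "E x (q x)"
      using q permutes_in_image[OF q(1), of x] by auto
    show ?thesis
    proof (cases "x = i")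
      case True
      then show ?thesis using high qx g by (fastforce simp: T_def)
    next
      case False
      then obtain j where j: "j \<in> T" "m j = Some x"
        using xS m by (force simp: S_def)
      \<comment> \<open>With \<open>g < p j\<close>, slackness leaves only prices from
        \<open>g\<close> upwards for \<open>q x\<close>, and \<open>g\<close> itself is no
        price.\<close>
      then have "p j \<le> Suc (p (q x))"
        using auc qx by (auto simp: auction_def T_def)
      then have "g \<le> p (q x)" using j by (simp add: T_def)
      then show ?thesis using g(2)[OF qx(1)] qx(1) by (simp add: T_def)
    qed
  qed
  then have "card S \<le> card T"
    using permutes_inj_on[OF q(1)] finT by (intro card_inj_on_le[of q]) auto
  then show False using card by simp
qed

text \<open>Each row picks a column that it owns; as a column has a single owner, the choice is
  injective.\<close>

lemma auction_complete:
  assumes "auction E n p m {..<n}"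
  shows "\<exists>q. q permutes {0..<n} \<and> (\<forall>i<n. E i (q i))"
proof -
  have "\<forall>i. \<exists>j. i < n \<longrightarrow> j < n \<and> m j = Some i"
    using assms by (auto simp: auction_def)
  then obtain f where f: "\<And>i. i < n \<Longrightarrow> f i < n \<and> m (f i) = Some i"
    by metis
  define q where "q = (\<lambda>i. if i < n then f i else i)"
  have "inj_on q {0..<n}"
    unfolding inj_on_def q_def using f by (metis atLeastLessThan_iff option.inject)
  moreover have "q ` {0..<n} \<subseteq> {0..<n}"
    using f by (auto simp: q_def)
  ultimately have "bij_betw q {0..<n} {0..<n}"
    by (simp add: bij_betw_def endo_inj_surj)
  then have "q permutes {0..<n}"
    by (rule bij_imp_permutes) (simp add: q_def)
  moreover have "E i (q i)" if "i < n" for i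
    using that f[OF that] assms by (auto simp: q_def auction_def)
  ultimately show ?thesis by blast
qed

section \<open>Running time in the unit-cost model\<close>

text \<open>A total-correctness triple with an upper bound on the unit cost. Sequential composition
  is handled by nesting \<open>runs\<close> in the postcondition.\<close>

definition runs :: "prog \<Rightarrow> state \<Rightarrow> nat \<Rightarrow> (state \<Rightarrow> bool) \<Rightarrow> bool" where
  "runs c \<sigma> T Q \<longleftrightarrow> (\<exists>t \<tau>. exec_unit c \<sigma> t \<tau> \<and> t \<le> T \<and> Q \<tau>)"

lemma runs_mono:
  "runs c \<sigma> T Q \<Longrightarrow> T \<le> T' \<Longrightarrow> (\<And>\<tau>. Q \<tau> \<Longrightarrow> Q' \<tau>) \<Longrightarrow> runs c \<sigma> T' Q'"
  unfolding runs_def by (meson le_trans)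

lemma runs_Skip: "Q \<sigma> \<Longrightarrow> runs Skip \<sigma> 1 Q"
  unfolding runs_def using exec.Skip by blast

lemma runs_Do: "Q (exec_instr i \<sigma>) \<Longrightarrow> runs (Do i) \<sigma> 1 Q"
  unfolding runs_def using exec.Do[of "\<lambda>_ _. 1"] by blast

lemma runs_Seq: "runs c \<sigma> T (\<lambda>\<sigma>'. runs d \<sigma>' U Q) \<Longrightarrow> runs (Seq c d) \<sigma> (T + U) Q"
  unfolding runs_def by (meson add_mono exec.Seq)

lemma runs_Cond:
  assumes "eval_test b \<sigma> \<Longrightarrow> runs c \<sigma> T Q" "\<not> eval_test b \<sigma> \<Longrightarrow> runs d \<sigma> T Q"
  shows "runs (Cond b c d) \<sigma> (Suc T) Q"
proof (cases "eval_test b \<sigma>")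
  case True
  then obtain t \<tau> where "exec_unit c \<sigma> t \<tau>" "t \<le> T" "Q \<tau>"
    using assms by (auto simp: runs_def)
  then show ?thesis
    using exec.Cond_True[OF True, of "\<lambda>_ _. 1" "\<lambda>_ _. 1" c t \<tau> d] by (auto simp: runs_def)
next
  case False
  then obtain t \<tau> where "exec_unit d \<sigma> t \<tau>" "t \<le> T" "Q \<tau>"
    using assms by (auto simp: runs_def)
  then show ?thesis
    using exec.Cond_False[OF False, of "\<lambda>_ _. 1" "\<lambda>_ _. 1" d t \<tau> c] by (auto simp: runs_def)
qed

text \<open>The variant \<open>f\<close> bounds the number of iterations. Each pays for the body and
  one test, and the final 1 is the failing test.\<close>

lemma runs_While:
  assumes step: "\<And>\<sigma>. I \<sigma> \<Longrightarrow> eval_test b \<sigma> \<Longrightarrow> runs c \<sigma> T (\<lambda>\<tau>. I \<tau> \<and> (f \<tau> :: nat) < f \<sigma>)"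
    and "I \<sigma>"
  shows "runs (While b c) \<sigma> (f \<sigma> * Suc T + 1) (\<lambda>\<tau>. I \<tau> \<and> \<not> eval_test b \<tau>)"
  using assms(2)
proof (induction "f \<sigma>" arbitrary: \<sigma> rule: less_induct)
  case less
  show ?case
  proof (cases "eval_test b \<sigma>")
    case True
    then obtain t \<sigma>' where t: "exec_unit c \<sigma> t \<sigma>'" "t \<le> T" "I \<sigma>'" "f \<sigma>' < f \<sigma>"
      using step[OF less.prems True] by (auto simp: runs_def)
    obtain u \<tau> where u: "exec_unit (While b c) \<sigma>' u \<tau>" "u \<le> f \<sigma>' * Suc T + 1" "I \<tau>" "\<not> eval_test b \<tau>"
      using less.hyps[OF t(4,3)] by (auto simp: runs_def)
    have "Suc (f \<sigma>') * Suc T \<le> f \<sigma> * Suc T"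
      using t(4) by (intro mult_le_mono1) simp
    then have "1 + t + u \<le> f \<sigma> * Suc T + 1"
      using t(2) u(2) by simp
    then show ?thesis
      unfolding runs_def using exec.While_True[OF True t(1) u(1)] u(3,4) by blast
  next
    case False
    then show ?thesis
      unfolding runs_def using exec.While_False[OF False, of "\<lambda>_ _. 1" "\<lambda>_ _. 1" c] less.prems by fastforce
  qed
qed

fun block :: "instr list \<Rightarrow> prog" where
  "block [] = Skip"
| "block (i # xs) = Seq (Do i) (block xs)"

text \<open>The extra unit is the cost of the closing \<open>Skip\<close>.\<close>

lemma runs_block: "Q (fold exec_instr xs \<sigma>) \<Longrightarrow> runs (block xs) \<sigma> (Suc (length xs)) Q"
proof (induction xs arbitrary: \<sigma>)
  case (Cons i xs)
  then have "runs (Do i) \<sigma> 1 (\<lambda>\<sigma>'. runs (block xs) \<sigma>' (Suc (length xs)) Q)"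
    by (intro runs_Do) simp
  then show ?case using runs_Seq by fastforce
qed (use runs_Skip in fastforce)

text \<open>Natural memory: 0 holds \<open>n\<close>; 1 the number \<open>u\<close> of rows already dealt with; 2 the base
  address \<open>i * n\<close> of the bidding row \<open>i\<close>; 3 the address \<open>u * n\<close>; 4 the scanned column; 5 and 6 the
  least price found, initially \<open>n + 1\<close>, and its address; 7 and 8 pointers to the price and the matrix
  entry of the scanned column; 9 is set to 1 on failure. Column \<open>j\<close> has its price in \<open>10 + 2 * j\<close>
  and its owner \<open>i\<close>, encoded as \<open>i * n + 1\<close>, in \<open>11 + 2 * j\<close>, where 0 means unowned. Since rows are
  represented by base addresses, no multiplication is needed.\<close>

definition scan_step :: prog where
  "scan_step = Seq
     (Cond (REq (RCell (Ind 8)) (RLit 0)) Skip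
       (Cond (NLess (NCell (Ind 7)) (NCell (Dir 5)))
         (block [NAdd (Dir 5) (NCell (Ind 7)) (NLit 0), NAdd (Dir 6) (NCell (Dir 7)) (NLit 0)])
         Skip))
     (block [NAdd (Dir 4) (NCell (Dir 4)) (NLit 1), NAdd (Dir 7) (NCell (Dir 7)) (NLit 2),
       NAdd (Dir 8) (NCell (Dir 8)) (NLit 1)])"

definition scan :: prog where
  "scan = Seq
     (block [NAdd (Dir 4) (NLit 0) (NLit 0), NAdd (Dir 5) (NCell (Dir 0)) (NLit 1),
       NAdd (Dir 7) (NLit 10) (NLit 0), NAdd (Dir 8) (NCell (Dir 2)) (NLit 0)])
     (While (NLess (NCell (Dir 4)) (NCell (Dir 0))) scan_step)"

text \<open>\<open>\<sigma>\<close> is the state before the scan and \<open>j\<close> the number of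
  columns scanned. A value of at most \<open>n\<close> in cell 5 is attained by a neighbour, so a
  final value of \<open>n + 1\<close> means that every neighbour costs more than
  \<open>n\<close>.\<close>

definition scan_inv :: "nat \<Rightarrow> state \<Rightarrow> state \<Rightarrow> bool" where
  "scan_inv j \<sigma> \<tau> \<longleftrightarrow> rmem \<tau> = rmem \<sigma> \<and> (\<forall>x. x < 4 \<or> 8 < x \<longrightarrow> nmem \<tau> x = nmem \<sigma> x) \<and>
     j \<le> nmem \<sigma> 0 \<and> nmem \<tau> 4 = j \<and> nmem \<tau> 7 = 10 + 2 * j \<and> nmem \<tau> 8 = nmem \<sigma> 2 + j \<and>
     nmem \<tau> 5 \<le> Suc (nmem \<sigma> 0) \<and>
     (\<forall>k<j. rmem \<sigma> (nmem \<sigma> 2 + k) \<noteq> 0 \<longrightarrow> nmem \<tau> 5 \<le> nmem \<sigma> (10 + 2 * k)) \<and>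
     (nmem \<tau> 5 \<le> nmem \<sigma> 0 \<longrightarrow> (\<exists>k<j. nmem \<tau> 6 = 10 + 2 * k \<and>
        nmem \<tau> 5 = nmem \<sigma> (10 + 2 * k) \<and> rmem \<sigma> (nmem \<sigma> 2 + k) \<noteq> 0))"

lemma runs_scan_step:
  assumes inv: "scan_inv j \<sigma> \<tau>" and j: "j < nmem \<sigma> 0"
  shows "runs scan_step \<tau> 10 (scan_inv (Suc j) \<sigma>)"
proof -
  let ?inc = "block [NAdd (Dir 4) (NCell (Dir 4)) (NLit 1), NAdd (Dir 7) (NCell (Dir 7)) (NLit 2),
       NAdd (Dir 8) (NCell (Dir 8)) (NLit 1)]"
  let ?price = "nmem \<sigma> (10 + 2 * j)"
  have price: "nmem \<tau> (10 + 2 * j) = ?price"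
    using inv by (simp add: scan_inv_def)
  have inc: "runs ?inc \<rho> 4 (scan_inv (Suc j) \<sigma>)"
    if "scan_inv (Suc j) \<sigma> (\<rho>\<lparr>nmem := (nmem \<rho>)(4 := nmem \<rho> 4 + 1, 7 := nmem \<rho> 7 + 2, 8 := nmem \<rho> 8 + 1)\<rparr>)" for \<rho>
    using that by (intro runs_mono[OF runs_block[of "scan_inv (Suc j) \<sigma>"]])
      (simp_all add: nat_store_def fun_upd_twist)
  \<comment> \<open>Two branches leave the minimum alone: a zero entry and a price that is no
    improvement.\<close>
  have skip: "scan_inv (Suc j) \<sigma> (\<tau>\<lparr>nmem := (nmem \<tau>)(4 := nmem \<tau> 4 + 1, 7 := nmem \<tau> 7 + 2, 8 := nmem \<tau> 8 + 1)\<rparr>)"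
    if "rmem \<sigma> (nmem \<sigma> 2 + j) = 0 \<or> nmem \<tau> 5 \<le> ?price"
    using inv j that unfolding scan_inv_def by (auto simp: less_Suc_eq)
  have take: "scan_inv (Suc j) \<sigma> (\<tau>\<lparr>nmem := (nmem \<tau>)(5 := ?price, 6 := 10 + 2 * j,
      4 := nmem \<tau> 4 + 1, 7 := nmem \<tau> 7 + 2, 8 := nmem \<tau> 8 + 1)\<rparr>)"
    if "rmem \<sigma> (nmem \<sigma> 2 + j) \<noteq> 0" "?price < nmem \<tau> 5"
    using inv j that unfolding scan_inv_def by (fastforce simp: less_Suc_eq)
  show ?thesis
    unfolding scan_step_def
  proof (rule runs_mono[OF runs_Seq[of _ _ 5 _ 4]])
    show "runs (Cond (REq (RCell (Ind 8)) (RLit 0)) Skip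
       (Cond (NLess (NCell (Ind 7)) (NCell (Dir 5)))
         (block [NAdd (Dir 5) (NCell (Ind 7)) (NLit 0), NAdd (Dir 6) (NCell (Dir 7)) (NLit 0)])
         Skip)) \<tau> 5 (\<lambda>\<rho>. runs ?inc \<rho> 4 (scan_inv (Suc j) \<sigma>))"
    proof (rule runs_mono[OF runs_Cond[where T = 4]])
      assume "eval_test (REq (RCell (Ind 8)) (RLit 0)) \<tau>"
      then have "rmem \<sigma> (nmem \<sigma> 2 + j) = 0" using inv by (simp add: scan_inv_def)
      then show "runs Skip \<tau> 4 (\<lambda>\<rho>. runs ?inc \<rho> 4 (scan_inv (Suc j) \<sigma>))"
        using runs_mono[OF runs_Skip[of "\<lambda>\<rho>. runs ?inc \<rho> 4 (scan_inv (Suc j) \<sigma>)", OF inc[OF skip]], of 4] by simp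
    next
      assume "\<not> eval_test (REq (RCell (Ind 8)) (RLit 0)) \<tau>"
      then have nz: "rmem \<sigma> (nmem \<sigma> 2 + j) \<noteq> 0" using inv by (simp add: scan_inv_def)
      show "runs (Cond (NLess (NCell (Ind 7)) (NCell (Dir 5)))
         (block [NAdd (Dir 5) (NCell (Ind 7)) (NLit 0), NAdd (Dir 6) (NCell (Dir 7)) (NLit 0)])
         Skip) \<tau> 4 (\<lambda>\<rho>. runs ?inc \<rho> 4 (scan_inv (Suc j) \<sigma>))"
      proof (rule runs_mono[OF runs_Cond[where T = 3]])
        assume "eval_test (NLess (NCell (Ind 7)) (NCell (Dir 5))) \<tau>"
        then have less: "?price < nmem \<tau> 5" using inv price by (simp add: scan_inv_def)
        have seven: "nmem \<tau> 7 = 10 + 2 * j" using inv by (simp add: scan_inv_def)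
        show "runs (block [NAdd (Dir 5) (NCell (Ind 7)) (NLit 0), NAdd (Dir 6) (NCell (Dir 7)) (NLit 0)])
           \<tau> 3 (\<lambda>\<rho>. runs ?inc \<rho> 4 (scan_inv (Suc j) \<sigma>))"
          by (rule runs_mono[OF runs_block], rule inc)
            (use take[OF nz less] price seven in \<open>simp_all add: nat_store_def\<close>)
      next
        assume "\<not> eval_test (NLess (NCell (Ind 7)) (NCell (Dir 5))) \<tau>"
        then have "nmem \<tau> 5 \<le> ?price" using inv price by (simp add: scan_inv_def)
        then show "runs Skip \<tau> 3 (\<lambda>\<rho>. runs ?inc \<rho> 4 (scan_inv (Suc j) \<sigma>))"
          using runs_mono[OF runs_Skip[of "\<lambda>\<rho>. runs ?inc \<rho> 4 (scan_inv (Suc j) \<sigma>)", OF inc[OF skip]], of 3] by simp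
      qed auto
    qed auto
  qed auto
qed

text \<open>The initial block costs 5, each of the \<open>n\<close> rounds at most 10 plus its test,
  and the last test 1.\<close>

lemma runs_scan: "runs scan \<sigma> (11 * nmem \<sigma> 0 + 6) (scan_inv (nmem \<sigma> 0) \<sigma>)"
proof -
  let ?I = "\<lambda>\<tau>. \<exists>j. scan_inv j \<sigma> \<tau>" and ?f = "\<lambda>\<tau>. nmem \<sigma> 0 - nmem \<tau> 4"
  let ?b = "NLess (NCell (Dir 4)) (NCell (Dir 0))"
  have loop: "runs (While ?b scan_step) \<tau> (11 * nmem \<sigma> 0 + 1) (scan_inv (nmem \<sigma> 0) \<sigma>)"
    if "scan_inv 0 \<sigma> \<tau>" for \<tau>
  proof (rule runs_mono[OF runs_While[where I = ?I and f = ?f and T = 10]])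
    fix \<rho> assume "?I \<rho>" "eval_test ?b \<rho>"
    then obtain j where j: "scan_inv j \<sigma> \<rho>" "nmem \<rho> 4 = j" "j < nmem \<sigma> 0"
      by (auto simp: scan_inv_def)
    then show "runs scan_step \<rho> 10 (\<lambda>\<tau>. ?I \<tau> \<and> ?f \<tau> < ?f \<rho>)"
      by (intro runs_mono[OF runs_scan_step[OF j(1)]]) (auto simp: scan_inv_def)
  next
    fix \<rho> assume "?I \<rho> \<and> \<not> eval_test ?b \<rho>"
    then obtain j where "scan_inv j \<sigma> \<rho>" "\<not> j < nmem \<sigma> 0" "j \<le> nmem \<sigma> 0"
      by (auto simp: scan_inv_def)
    then show "scan_inv (nmem \<sigma> 0) \<sigma> \<rho>" by (metis le_neq_implies_less)
  qed (use that in \<open>auto simp: scan_inv_def\<close>)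
  show ?thesis
    unfolding scan_def
    by (rule runs_mono[OF runs_Seq[OF runs_block]], rule loop)
      (auto simp: scan_inv_def nat_store_def)
qed

text \<open>On failure, cell 0 is cleared in order to leave the main loop.\<close>

definition bid_step :: prog where
  "bid_step = Seq scan
     (Cond (NLess (NCell (Dir 0)) (NCell (Dir 5)))
       (block [NAdd (Dir 0) (NLit 0) (NLit 0), NAdd (Dir 9) (NLit 1) (NLit 0)])
       (Seq
         (block [NAdd (Ind 6) (NCell (Ind 6)) (NLit 1), NAdd (Dir 6) (NCell (Dir 6)) (NLit 1),
           NAdd (Dir 4) (NCell (Ind 6)) (NLit 0), NAdd (Ind 6) (NCell (Dir 2)) (NLit 1)])
         (Cond (NEq (NCell (Dir 4)) (NLit 0))
           (block [NAdd (Dir 1) (NCell (Dir 1)) (NLit 1),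
             NAdd (Dir 3) (NCell (Dir 3)) (NCell (Dir 0)), NAdd (Dir 2) (NCell (Dir 3)) (NLit 0)])
           (block [NSub (Dir 2) (NCell (Dir 4)) (NLit 1)]))))"

text \<open>The closing subtraction negates the failure flag into cell 0.\<close>

definition matching_prog :: prog where
  "matching_prog = Seq (While (NLess (NCell (Dir 1)) (NCell (Dir 0))) bid_step)
     (Do (NSub (Dir 0) (NLit 1) (NCell (Dir 9))))"

text \<open>Phrased over the real memory, so that the program is verified as a matching algorithm
  independently of signings.\<close>

definition row_edge :: "nat \<Rightarrow> (nat \<Rightarrow> real) \<Rightarrow> nat \<Rightarrow> nat \<Rightarrow> bool" where
  "row_edge n R i j \<longleftrightarrow> R (i * n + j) \<noteq> 0"

definition perfect :: "nat \<Rightarrow> (nat \<Rightarrow> nat \<Rightarrow> bool) \<Rightarrow> bool" where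
  "perfect n E \<longleftrightarrow> (\<exists>q. q permutes {0..<n} \<and> (\<forall>i<n. E i (q i)))"

fun mate_code :: "nat \<Rightarrow> nat option \<Rightarrow> nat" where
  "mate_code n None = 0"
| "mate_code n (Some i) = Suc (i * n)"

text \<open>All rows up to \<open>u\<close> own a column except the bidder \<open>i\<close>. At
  \<open>u = n\<close> the bidder is the fictitious row \<open>n\<close>, so exactly the rows below
  \<open>n\<close> own columns.\<close>

definition running :: "nat \<Rightarrow> (nat \<Rightarrow> nat \<Rightarrow> bool) \<Rightarrow> (nat \<Rightarrow> nat) \<Rightarrow> nat \<Rightarrow> nat \<Rightarrow> (nat \<Rightarrow> nat option) \<Rightarrow> bool" where
  "running n E f u i m \<longleftrightarrow> f 0 = n \<and> f 1 = u \<and> f 2 = i * n \<and> f 3 = u * n \<and> f 9 = 0 \<and>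
     (\<forall>j<n. f (11 + 2 * j) = mate_code n (m j)) \<and> i \<le> u \<and> u \<le> n \<and> (u = n \<longrightarrow> i = n) \<and>
     auction E n (\<lambda>j. f (10 + 2 * j)) m ({..u} - {i})"

definition failed :: "nat \<Rightarrow> (nat \<Rightarrow> nat \<Rightarrow> bool) \<Rightarrow> (nat \<Rightarrow> nat) \<Rightarrow> bool" where
  "failed n E f \<longleftrightarrow> f 0 = 0 \<and> f 9 = 1 \<and> \<not> perfect n E"

text \<open>A successful bid raises a price that is at most \<open>n\<close>, which lowers the sum.
  The leading \<open>Suc\<close> lets a failing round decrease the potential as well.\<close>

definition potential :: "nat \<Rightarrow> (nat \<Rightarrow> nat) \<Rightarrow> nat" where
  "potential n f = (if f 9 = 0 then Suc (\<Sum>j<n. Suc n - f (10 + 2 * j)) else 0)"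

definition bid_inv :: "nat \<Rightarrow> (nat \<Rightarrow> nat \<Rightarrow> bool) \<Rightarrow> (nat \<Rightarrow> nat) \<Rightarrow> bool" where
  "bid_inv n E f \<longleftrightarrow> failed n E f \<or> (\<exists>u i m. running n E f u i m)"

lemma potential_less:
  assumes "f 9 = 0" "g 9 = 0" "b < n" "f (10 + 2 * b) \<le> n" "g (10 + 2 * b) = Suc (f (10 + 2 * b))"
    and "\<And>j. j < n \<Longrightarrow> j \<noteq> b \<Longrightarrow> g (10 + 2 * j) = f (10 + 2 * j)"
  shows "potential n g < potential n f"
proof -
  have "(\<Sum>j<n. Suc n - g (10 + 2 * j)) < (\<Sum>j<n. Suc n - f (10 + 2 * j))"
  proof (rule sum_strict_mono_ex1)
    show "\<forall>j\<in>{..<n}. Suc n - g (10 + 2 * j) \<le> Suc n - f (10 + 2 * j)"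
    proof
      fix j assume "j \<in> {..<n}"
      then show "Suc n - g (10 + 2 * j) \<le> Suc n - f (10 + 2 * j)"
        using assms(5) assms(6)[of j] by (cases "j = b") auto
    qed
    show "\<exists>j\<in>{..<n}. Suc n - g (10 + 2 * j) < Suc n - f (10 + 2 * j)"
      using assms(3-5) by (intro bexI[of _ b]) auto
  qed simp
  then show ?thesis using assms(1,2) by (simp add: potential_def)
qed

lemma price_mate_cells_disjoint: "11 + 2 * b \<noteq> 10 + 2 * (j :: nat)"
  by presburger

lemma runs_bid_step:
  assumes R: "rmem \<sigma> = R" and run: "running n (row_edge n R) (nmem \<sigma>) u i m" and u: "u < n"
  shows "runs bid_step \<sigma> (11 * n + 20) (\<lambda>\<tau>. rmem \<tau> = R \<and> bid_inv n (row_edge n R) (nmem \<tau>)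
    \<and> potential n (nmem \<tau>) < potential n (nmem \<sigma>))"
    (is "runs _ _ _ ?Q")
proof -
  let ?E = "row_edge n R" and ?p = "\<lambda>j. nmem \<sigma> (10 + 2 * j)"
  have f: "nmem \<sigma> 0 = n" "nmem \<sigma> 1 = u" "nmem \<sigma> 2 = i * n" "nmem \<sigma> 3 = u * n" "nmem \<sigma> 9 = 0"
    and mates: "\<And>j. j < n \<Longrightarrow> nmem \<sigma> (11 + 2 * j) = mate_code n (m j)"
    and iu: "i \<le> u" and auc: "auction ?E n ?p m ({..u} - {i})"
    using run by (auto simp: running_def)
  let ?update = "[NAdd (Ind 6) (NCell (Ind 6)) (NLit 1), NAdd (Dir 6) (NCell (Dir 6)) (NLit 1),
           NAdd (Dir 4) (NCell (Ind 6)) (NLit 0), NAdd (Ind 6) (NCell (Dir 2)) (NLit 1)]"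
  let ?next = "Cond (NEq (NCell (Dir 4)) (NLit 0))
           (block [NAdd (Dir 1) (NCell (Dir 1)) (NLit 1),
             NAdd (Dir 3) (NCell (Dir 3)) (NCell (Dir 0)), NAdd (Dir 2) (NCell (Dir 3)) (NLit 0)])
           (block [NSub (Dir 2) (NCell (Dir 4)) (NLit 1)])"
  have "runs (Cond (NLess (NCell (Dir 0)) (NCell (Dir 5)))
       (block [NAdd (Dir 0) (NLit 0) (NLit 0), NAdd (Dir 9) (NLit 1) (NLit 0)])
       (Seq (block ?update) ?next)) \<tau> 14 ?Q" (is "runs (Cond ?b ?c ?d) _ _ _")
    if scan: "scan_inv n \<sigma> \<tau>" for \<tau>
  proof (rule runs_mono[OF runs_Cond[where T = 13 and Q = ?Q]])
    have same: "nmem \<tau> x = nmem \<sigma> x" if "x < 4 \<or> 8 < x" for x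
      using scan that by (auto simp: scan_inv_def)
    have Rt: "rmem \<tau> = R"
      using scan R by (simp add: scan_inv_def)
    have best: "nmem \<tau> 5 \<le> ?p k" if "k < n" "?E i k" for k
      using scan that f R by (auto simp: scan_inv_def row_edge_def)
    {
      assume "eval_test ?b \<tau>"
      then have "n < nmem \<tau> 5" using same[of 0] f by simp
      then have "n < ?p k" if "k < n" "?E i k" for k
        using best[OF that] by simp
      moreover have "i < n" "{..u} - {i} \<subseteq> {..<n}"
        using iu u by auto
      ultimately have "\<not> perfect n ?E"
        using auction_stuck[OF auc, of i] unfolding perfect_def by blast
      then have "?Q (fold exec_instr [NAdd (Dir 0) (NLit 0) (NLit 0), NAdd (Dir 9) (NLit 1) (NLit 0)] \<tau>)"
        using Rt f by (simp add: bid_inv_def failed_def potential_def nat_store_def)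
      then show "runs ?c \<tau> 13 ?Q"
        by (rule runs_mono[OF runs_block]) simp_all
    next
      assume "\<not> eval_test ?b \<tau>"
      then have "nmem \<tau> 5 \<le> n" using same[of 0] f by simp
      then obtain b where b: "b < n" "nmem \<tau> 6 = 10 + 2 * b" "nmem \<tau> 5 = ?p b" "?E i b" "?p b \<le> n"
        using scan f R by (auto simp: scan_inv_def row_edge_def)
      \<comment> \<open>The memory after the update: price raised, cell 6 moved on to the owner
        cell, previous owner saved in cell 4, new owner entered.\<close>
      define g where "g = (nmem \<tau>)(10 + 2 * b := Suc (?p b), 6 := 11 + 2 * b,
        4 := mate_code n (m b), 11 + 2 * b := Suc (i * n))"
      have upd: "fold exec_instr ?update \<tau> = \<tau>\<lparr>nmem := g\<rparr>"
        using b(2) f same mates[OF b(1)] by (simp add: nat_store_def g_def fun_upd_twist)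
      have auc': "auction ?E n (?p(b := Suc (?p b))) (m(b := Some i)) ({..u} - set_option (m b))"
        using auction_bid[OF auc _ b(1,4)] best b(3) iu by (simp add: insert_absorb)
      have gp: "g (10 + 2 * j) = (?p(b := Suc (?p b))) j" for j
        using price_mate_cells_disjoint[of b j] same by (simp add: g_def)
      have gm: "g (11 + 2 * j) = mate_code n ((m(b := Some i)) j)" if "j < n" for j
        using price_mate_cells_disjoint[of j b] same mates[OF that] by (auto simp: g_def)
      have g: "g 0 = n" "g 1 = u" "g 2 = i * n" "g 3 = u * n" "g 4 = mate_code n (m b)" "g 9 = 0"
        using f same by (auto simp: g_def)
      \<comment> \<open>The potential reads only cells above 8, so choosing the next bidder does not
        affect it.\<close>
      have pot: "potential n h < potential n (nmem \<sigma>)" if "\<And>x. 8 < x \<Longrightarrow> h x = g x" for h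
        by (rule potential_less[of _ _ b]) (use that f g gp b in auto)
      have "runs ?next (\<tau>\<lparr>nmem := g\<rparr>) 5 ?Q"
      proof (rule runs_mono[OF runs_Cond[where T = 4 and Q = ?Q]])
        assume "eval_test (NEq (NCell (Dir 4)) (NLit 0)) (\<tau>\<lparr>nmem := g\<rparr>)"
        then have None: "m b = None" using g by (cases "m b") auto
        \<comment> \<open>Nobody was displaced, so the next fresh row bids.\<close>
        define h where "h = g(1 := Suc u, 3 := Suc u * n, 2 := Suc u * n)"
        have "running n ?E h (Suc u) (Suc u) (m(b := Some i))"
          unfolding running_def
        proof (intro conjI)
          show "auction ?E n (\<lambda>j. h (10 + 2 * j)) (m(b := Some i)) ({..Suc u} - {Suc u})"
            by (rule auction_cong[OF auc']) (auto simp: gp h_def None)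
        qed (use g gm u in \<open>auto simp: h_def\<close>)
        then have "?Q (\<tau>\<lparr>nmem := h\<rparr>)"
          using pot[of h] Rt by (auto simp: bid_inv_def h_def)
        then show "runs (block [NAdd (Dir 1) (NCell (Dir 1)) (NLit 1),
             NAdd (Dir 3) (NCell (Dir 3)) (NCell (Dir 0)), NAdd (Dir 2) (NCell (Dir 3)) (NLit 0)])
             (\<tau>\<lparr>nmem := g\<rparr>) 4 ?Q"
          by (intro runs_mono[OF runs_block[where Q = ?Q]])
            (simp_all add: nat_store_def h_def g g(2)[unfolded One_nat_def] fun_upd_twist add.commute)
      next
        assume "\<not> eval_test (NEq (NCell (Dir 4)) (NLit 0)) (\<tau>\<lparr>nmem := g\<rparr>)"
        then obtain i' where Some: "m b = Some i'" using g by (cases "m b") auto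
        then have "i' \<in> {..u} - {i}"
          using auc b(1) unfolding auction_def by blast
        then have i': "i' \<le> u" by simp
        \<comment> \<open>The displaced row bids next; its owner code minus 1 is its base
          address.\<close>
        define h where "h = g(2 := i' * n)"
        have "running n ?E h u i' (m(b := Some i))"
          unfolding running_def
        proof (intro conjI)
          show "auction ?E n (\<lambda>j. h (10 + 2 * j)) (m(b := Some i)) ({..u} - {i'})"
            by (rule auction_cong[OF auc']) (auto simp: gp h_def Some)
        qed (use g gm u i' in \<open>auto simp: h_def\<close>)
        then have "?Q (\<tau>\<lparr>nmem := h\<rparr>)"
          using pot[of h] Rt by (auto simp: bid_inv_def h_def)
        then show "runs (block [NSub (Dir 2) (NCell (Dir 4)) (NLit 1)]) (\<tau>\<lparr>nmem := g\<rparr>) 4 ?Q"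
          by (intro runs_mono[OF runs_block[where Q = ?Q]]) (simp_all add: nat_store_def h_def g Some)
      qed auto
      then have "runs (block ?update) \<tau> (Suc (length ?update)) (\<lambda>\<rho>. runs ?next \<rho> 5 ?Q)"
        by (intro runs_block) (simp only: upd)
      from runs_Seq[OF this] show "runs ?d \<tau> 13 ?Q"
        by (rule runs_mono) simp_all
    }
  qed simp_all
  then show ?thesis
    unfolding bid_step_def
    by (intro runs_mono[OF runs_Seq[where T = "11 * n + 6" and U = 14]] runs_mono[OF runs_scan]) (simp_all add: f)
qed

text \<open>With all prices 0 the potential is \<open>Suc (n * Suc n)\<close>, which bounds the
  number of rounds; a round costs at most \<open>11 * n + 20\<close> plus its test.\<close>

lemma runs_matching_prog:
  assumes R: "rmem \<sigma> = R" and f: "nmem \<sigma> = (\<lambda>_. 0)(0 := n)"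
  shows "runs matching_prog \<sigma> (Suc (n * Suc n) * (11 * n + 21) + 2)
    (\<lambda>\<tau>. answer \<tau> (perfect n (row_edge n R)))"
proof -
  let ?E = "row_edge n R"
  let ?I = "\<lambda>\<tau>. rmem \<tau> = R \<and> bid_inv n ?E (nmem \<tau>)" and ?b = "NLess (NCell (Dir 1)) (NCell (Dir 0))"
  have "auction ?E n (\<lambda>j. nmem \<sigma> (10 + 2 * j)) (\<lambda>_. None) ({..0} - {0})"
    by (rule auction_cong[OF auction_init]) (auto simp: f)
  then have "running n ?E (nmem \<sigma>) 0 0 (\<lambda>_. None)"
    by (simp add: running_def f)
  then have I: "?I \<sigma>"
    using R by (auto simp: bid_inv_def)
  have "runs (While ?b bid_step) \<sigma> (potential n (nmem \<sigma>) * Suc (11 * n + 20) + 1)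
      (\<lambda>\<tau>. ?I \<tau> \<and> \<not> eval_test ?b \<tau>)"
  proof (rule runs_While[where f = "\<lambda>\<tau>. potential n (nmem \<tau>)" and I = ?I, OF _ I])
    fix \<tau> assume I: "?I \<tau>" and b: "eval_test ?b \<tau>"
    then have "\<not> failed n ?E (nmem \<tau>)"
      by (auto simp: failed_def)
    then obtain u i m where run: "running n ?E (nmem \<tau>) u i m"
      using I by (auto simp: bid_inv_def)
    then have "u < n" using b by (simp add: running_def)
    with run I show "runs bid_step \<tau> (11 * n + 20) (\<lambda>\<rho>. ?I \<rho> \<and> potential n (nmem \<rho>) < potential n (nmem \<tau>))"
      by (intro runs_mono[OF runs_bid_step]) auto
  qed
  moreover have "potential n (nmem \<sigma>) = Suc (n * Suc n)"
    by (simp add: potential_def f)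
  ultimately have "runs (While ?b bid_step) \<sigma> (Suc (n * Suc n) * Suc (11 * n + 20) + 1)
      (\<lambda>\<tau>. runs (Do (NSub (Dir 0) (NLit 1) (NCell (Dir 9)))) \<tau> 1 (\<lambda>\<tau>. answer \<tau> (perfect n ?E)))"
  proof (elim runs_mono)
    fix \<tau> assume \<tau>: "?I \<tau> \<and> \<not> eval_test ?b \<tau>"
    show "runs (Do (NSub (Dir 0) (NLit 1) (NCell (Dir 9)))) \<tau> 1 (\<lambda>\<tau>. answer \<tau> (perfect n ?E))"
    proof (rule runs_Do, cases "failed n ?E (nmem \<tau>)")
      case True
      then show "answer (exec_instr (NSub (Dir 0) (NLit 1) (NCell (Dir 9))) \<tau>) (perfect n ?E)"
        by (simp add: failed_def answer_def nat_store_def)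
    next
      case False
      then obtain u i m where run: "running n ?E (nmem \<tau>) u i m"
        using \<tau> by (auto simp: bid_inv_def)
      then have "u = n" "i = n"
        using \<tau> by (auto simp: running_def)
      moreover have "{..n} - {n} = {..<n}" by auto
      ultimately have "perfect n ?E"
        using run auction_complete[of ?E n] by (auto simp: running_def perfect_def)
      then show "answer (exec_instr (NSub (Dir 0) (NLit 1) (NCell (Dir 9))) \<tau>) (perfect n ?E)"
        using run by (simp add: running_def answer_def nat_store_def)
    qed
  qed simp
  from runs_Seq[OF this] show ?thesis
    unfolding matching_prog_def by (rule runs_mono) simp_all
qed

section \<open>Bit cost\<close>

text \<open>Writing real cells is excluded but testing them is not, so real numbers keep their input
  length.\<close>

fun integer_prog :: "prog \<Rightarrow> bool" where
  "integer_prog Skip \<longleftrightarrow> True"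
| "integer_prog (Do (NAdd _ _ _)) \<longleftrightarrow> True"
| "integer_prog (Do (NSub _ _ _)) \<longleftrightarrow> True"
| "integer_prog (Do _) \<longleftrightarrow> False"
| "integer_prog (Seq c d) \<longleftrightarrow> integer_prog c \<and> integer_prog d"
| "integer_prog (Cond _ c d) \<longleftrightarrow> integer_prog c \<and> integer_prog d"
| "integer_prog (While _ c) \<longleftrightarrow> integer_prog c"

text \<open>These functions add up the literals and fixed addresses of a program, with the bit
  length in place of a real literal. Such crude bounds suffice because the program is fixed.\<close>

fun loc_const :: "loc \<Rightarrow> nat" where
  "loc_const (Dir i) = i"
| "loc_const (Ind i) = i"

fun nat_operand_const :: "nat_operand \<Rightarrow> nat" where
  "nat_operand_const (NLit k) = k"
| "nat_operand_const (NCell l) = loc_const l"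

fun real_operand_const :: "real_operand \<Rightarrow> nat" where
  "real_operand_const (RLit k) = rat_bits (real_of_int k)"
| "real_operand_const (RCell l) = loc_const l"

fun instr_const :: "instr \<Rightarrow> nat" where
  "instr_const (NAdd l a b) = loc_const l + nat_operand_const a + nat_operand_const b"
| "instr_const (NSub l a b) = loc_const l + nat_operand_const a + nat_operand_const b"
| "instr_const (RAdd l a b) = loc_const l + real_operand_const a + real_operand_const b"
| "instr_const (RSub l a b) = loc_const l + real_operand_const a + real_operand_const b"
| "instr_const (RMul l a b) = loc_const l + real_operand_const a + real_operand_const b"
| "instr_const (RDiv l a b) = loc_const l + real_operand_const a + real_operand_const b"

fun test_const :: "test \<Rightarrow> nat" where
  "test_const (NLess a b) = nat_operand_const a + nat_operand_const b"
| "test_const (NEq a b) = nat_operand_const a + nat_operand_const b"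
| "test_const (RLess a b) = real_operand_const a + real_operand_const b"
| "test_const (REq a b) = real_operand_const a + real_operand_const b"

fun prog_const :: "prog \<Rightarrow> nat" where
  "prog_const Skip = 0"
| "prog_const (Do i) = instr_const i"
| "prog_const (Seq c d) = prog_const c + prog_const d"
| "prog_const (Cond b c d) = test_const b + prog_const c + prog_const d"
| "prog_const (While b c) = test_const b + prog_const c"

definition bounded_state :: "nat \<Rightarrow> nat \<Rightarrow> state \<Rightarrow> bool" where
  "bounded_state b r \<sigma> \<longleftrightarrow> (\<forall>x. nmem \<sigma> x < 2 ^ b) \<and> (\<forall>x. rat_bits (rmem \<sigma> x) \<le> r)"

lemma bounded_state_mono: "bounded_state b r \<sigma> \<Longrightarrow> b \<le> b' \<Longrightarrow> bounded_state b' r \<sigma>"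
  unfolding bounded_state_def
  by (meson less_le_trans one_le_numeral power_increasing)

lemma nat_bits_le:
  assumes "v < 2 ^ b"
  shows "nat_bits v \<le> Suc b"
proof (cases "v = 0")
  case False
  then have "(2 :: nat) ^ floor_log v < 2 ^ b"
    using le_less_trans[OF floor_log_exp2_le assms] by simp
  then have "floor_log v < b"
    by simp
  then show ?thesis by (simp add: nat_bits_def)
qed (simp add: nat_bits_def)

lemma nat_bits_le_self: "v \<le> b \<Longrightarrow> nat_bits v \<le> Suc b"
  by (rule nat_bits_le) (meson less_exp le_less_trans)

context
  fixes b r :: nat and \<sigma> :: state
  assumes bounded: "bounded_state b r \<sigma>"
begin

lemma nat_bits_cell: "nat_bits (nmem \<sigma> x) \<le> Suc b"
  using bounded nat_bits_le by (simp add: bounded_state_def)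

lemma addr_bits_le: "loc_const l \<le> b \<Longrightarrow> addr_bits l \<sigma> \<le> 2 * Suc b"
  using nat_bits_cell[of "loc_const l"] nat_bits_le_self[of "loc_const l" b]
  by (cases l) auto

lemma nat_operand_bits_le: "nat_operand_const a \<le> b \<Longrightarrow> nat_operand_bits a \<sigma> \<le> 3 * Suc b"
proof (cases a)
  case (NCell l)
  assume "nat_operand_const a \<le> b"
  then show ?thesis
    using NCell addr_bits_le[of l] nat_bits_cell[of "addr l \<sigma>"] by simp
qed (use nat_bits_le_self in fastforce)

lemma real_operand_bits_le: "real_operand_const a \<le> b \<Longrightarrow> real_operand_bits a \<sigma> \<le> 2 * Suc b + r"
proof (cases a)
  case (RCell l)
  assume "real_operand_const a \<le> b"
  moreover have "rat_bits (rmem \<sigma> (addr l \<sigma>)) \<le> r"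
    using bounded by (simp add: bounded_state_def)
  ultimately show ?thesis
    using RCell addr_bits_le[of l] by simp
qed simp

lemma test_bits_le:
  assumes "test_const t \<le> b"
  shows "test_bits t \<sigma> \<le> 8 * Suc b + 2 * r"
proof (cases t)
  case (NLess x y)
  then show ?thesis using assms nat_operand_bits_le[of x] nat_operand_bits_le[of y] by simp
next
  case (NEq x y)
  then show ?thesis using assms nat_operand_bits_le[of x] nat_operand_bits_le[of y] by simp
next
  case (RLess x y)
  then show ?thesis using assms real_operand_bits_le[of x] real_operand_bits_le[of y] by simp
next
  case (REq x y)
  then show ?thesis using assms real_operand_bits_le[of x] real_operand_bits_le[of y] by simp
qed

lemma nat_val_less: "nat_operand_const a \<le> b \<Longrightarrow> nat_val a \<sigma> < 2 ^ b"
proof (cases a)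
  case (NLit k)
  assume "nat_operand_const a \<le> b"
  then show ?thesis using NLit le_less_trans[OF _ less_exp] by simp
qed (use bounded in \<open>simp add: bounded_state_def\<close>)

text \<open>A sum of two numbers below \<open>2 ^ b\<close> is below \<open>2 ^ Suc b\<close>, and a
  difference is no larger than the sum. The factor 8 is 2 for the target and 3 for each
  operand.\<close>

lemma integer_instr_bits:
  assumes "integer_prog (Do i)" "instr_const i \<le> b"
  shows "instr_bits i \<sigma> \<le> 8 * Suc b" "bounded_state (Suc b) r (exec_instr i \<sigma>)"
proof -
  obtain l x y where i: "i = NAdd l x y \<or> i = NSub l x y"
    using assms(1) by (cases i) auto
  then have c: "loc_const l \<le> b" "nat_operand_const x \<le> b" "nat_operand_const y \<le> b"
    using assms(2) by auto
  show "instr_bits i \<sigma> \<le> 8 * Suc b"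
    using i addr_bits_le[OF c(1)] nat_operand_bits_le[OF c(2)] nat_operand_bits_le[OF c(3)] by auto
  have "nat_val x \<sigma> + nat_val y \<sigma> < 2 ^ Suc b"
    using nat_val_less[OF c(2)] nat_val_less[OF c(3)] by simp
  moreover have "nmem \<sigma> z < 2 ^ Suc b" for z
    using bounded_state_mono[OF bounded, of "Suc b"] by (simp add: bounded_state_def)
  ultimately show "bounded_state (Suc b) r (exec_instr i \<sigma>)"
    using i bounded by (auto simp: bounded_state_def nat_store_def)
qed

end

text \<open>Every unit of time adds at most one bit to the natural numbers. All intermediate numbers
  are thus below \<open>2 ^ B\<close>, which bounds the bit cost per unit.\<close>

lemma exec_bits_of_exec_unit:
  assumes "exec_unit c \<sigma> t \<tau>" "integer_prog c" "prog_const c \<le> b" "bounded_state b r \<sigma>" "b + t \<le> B"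
  shows "bounded_state (b + t) r \<tau> \<and> (\<exists>t'. exec_bits c \<sigma> t' \<tau> \<and> t' \<le> t * (8 * Suc B + 2 * r))"
proof -
  \<comment> \<open>\<open>B\<close> stays fixed while \<open>b\<close> grows in the induction, so
    \<open>K\<close> bounds every single step uniformly.\<close>
  define K where "K = 8 * Suc B + 2 * r"
  have K: "8 * Suc b + 2 * r \<le> K" if "b \<le> B" for b
    using that by (simp add: K_def)
  have "bounded_state (b + t) r \<tau> \<and> (\<exists>t'. exec_bits c \<sigma> t' \<tau> \<and> t' \<le> t * K)"
    using assms
  proof (induction arbitrary: b rule: exec.induct)
    case (Skip \<sigma>)
    then show ?case
      using exec.Skip[of instr_bits test_bits \<sigma>] bounded_state_mono[of b r \<sigma> "b + 1"]
      by (auto simp: K_def intro!: exI[of _ 1])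
  next
    case (Do i \<sigma>)
    have "instr_bits i \<sigma> \<le> K"
      using integer_instr_bits(1)[OF Do(3,1)] Do(2,4) K[of b] by simp
    then show ?case
      using integer_instr_bits(2)[OF Do(3,1)] Do(2) exec.Do[of instr_bits test_bits i \<sigma>] by auto
  next
    case (Seq c \<sigma> t \<sigma>' d u \<tau>)
    have c: "bounded_state (b + t) r \<sigma>'" "\<exists>t'. exec_bits c \<sigma> t' \<sigma>' \<and> t' \<le> t * K"
      using Seq.IH(1)[of b] Seq.prems by auto
    have d: "bounded_state (b + t + u) r \<tau>" "\<exists>u'. exec_bits d \<sigma>' u' \<tau> \<and> u' \<le> u * K"
      using Seq.IH(2)[of "b + t"] Seq.prems c(1) by (auto simp: add.assoc)
    from c(2) d(2) obtain t' u' where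
      "exec_bits c \<sigma> t' \<sigma>'" "t' \<le> t * K" "exec_bits d \<sigma>' u' \<tau>" "u' \<le> u * K" by blast
    then show ?case
      using d(1) exec.Seq[of instr_bits test_bits c \<sigma> t' \<sigma>' d u' \<tau>]
      by (auto simp: add.assoc add_mult_distrib intro!: exI[of _ "t' + u'"])
  next
    case (Cond_True e \<sigma> c t \<tau> d)
    have c: "bounded_state (b + t) r \<tau>" "\<exists>t'. exec_bits c \<sigma> t' \<tau> \<and> t' \<le> t * K"
      using Cond_True.IH[of b] Cond_True.prems by auto
    then obtain t' where t': "exec_bits c \<sigma> t' \<tau>" "t' \<le> t * K" by blast
    have "test_bits e \<sigma> \<le> K"
      using test_bits_le[of b r \<sigma> e] Cond_True.prems K[of b] by simp
    then show ?case
      using bounded_state_mono[OF c(1), of "b + (1 + t)"] t'(2)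
        exec.Cond_True[of e \<sigma> instr_bits test_bits c t' \<tau> d, OF Cond_True.hyps(1) t'(1)]
      by (auto intro!: exI[of _ "test_bits e \<sigma> + t'"])
  next
    case (Cond_False e \<sigma> d t \<tau> c)
    have c: "bounded_state (b + t) r \<tau>" "\<exists>t'. exec_bits d \<sigma> t' \<tau> \<and> t' \<le> t * K"
      using Cond_False.IH[of b] Cond_False.prems by auto
    then obtain t' where t': "exec_bits d \<sigma> t' \<tau>" "t' \<le> t * K" by blast
    have "test_bits e \<sigma> \<le> K"
      using test_bits_le[of b r \<sigma> e] Cond_False.prems K[of b] by simp
    then show ?case
      using bounded_state_mono[OF c(1), of "b + (1 + t)"] t'(2)
        exec.Cond_False[of e \<sigma> instr_bits test_bits d t' \<tau> c, OF Cond_False.hyps(1) t'(1)]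
      by (auto intro!: exI[of _ "test_bits e \<sigma> + t'"])
  next
    case (While_False e \<sigma> c)
    have "test_bits e \<sigma> \<le> K"
      using test_bits_le[of b r \<sigma> e] While_False.prems K[of b] by simp
    then show ?case
      using bounded_state_mono[of b r \<sigma> "b + 1"] While_False.prems
        exec.While_False[of e \<sigma> instr_bits test_bits c, OF While_False.hyps]
      by (auto intro!: exI[of _ "test_bits e \<sigma>"])
  next
    case (While_True e \<sigma> c t \<sigma>' u \<tau>)
    have c: "bounded_state (b + t) r \<sigma>'" "\<exists>t'. exec_bits c \<sigma> t' \<sigma>' \<and> t' \<le> t * K"
      using While_True.IH(1)[of b] While_True.prems by auto
    have d: "bounded_state (b + t + u) r \<tau>" "\<exists>u'. exec_bits (While e c) \<sigma>' u' \<tau> \<and> u' \<le> u * K"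
      using While_True.IH(2)[of "b + t"] While_True.prems c(1) by (auto simp: add.assoc)
    from c(2) d(2) obtain t' u' where t': "exec_bits c \<sigma> t' \<sigma>'" "t' \<le> t * K"
      and u': "exec_bits (While e c) \<sigma>' u' \<tau>" "u' \<le> u * K" by blast
    have "test_bits e \<sigma> \<le> K"
      using test_bits_le[of b r \<sigma> e] While_True.prems K[of b] by simp
    then show ?case
      using bounded_state_mono[OF d(1), of "b + (1 + t + u)"] t'(2) u'(2)
        exec.While_True[of e \<sigma> instr_bits test_bits c t' \<sigma>' u' \<tau>, OF While_True.hyps(1) t'(1) u'(1)]
      by (auto simp: add_mult_distrib intro!: exI[of _ "test_bits e \<sigma> + t' + u'"])
  qed
  then show ?thesis by (simp add: K_def)
qed

section \<open>Bit length of the input matrix\<close>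

lemma nat_bits_pos: "nat_bits v \<ge> 1"
  by (simp add: nat_bits_def)

lemma rat_bits_pos: "rat_bits x \<ge> 1"
  using nat_bits_pos by (auto simp: rat_bits_def Let_def split: prod.split intro: trans_le_add1)

lemma rat_bits_le_mat_bits:
  assumes "i < dim_row M" "j < dim_col M"
  shows "rat_bits (M $$ (i, j)) \<le> mat_bits M"
proof -
  have "rat_bits (M $$ (i, j)) \<le> (\<Sum>j<dim_col M. rat_bits (M $$ (i, j)))"
    using assms by (intro member_le_sum) auto
  also have "\<dots> \<le> mat_bits M"
    unfolding mat_bits_def using assms
    by (intro member_le_sum[where f = "\<lambda>i. \<Sum>j<dim_col M. rat_bits (M $$ (i, j))"]) auto
  finally show ?thesis .
qed

text \<open>Each row has an entry of at least one bit. This turns time bounds in the dimension into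
  bounds in the bit length.\<close>

lemma dim_row_le_mat_bits:
  assumes "square_mat M"
  shows "dim_row M \<le> mat_bits M"
proof (cases "dim_row M = 0")
  case False
  have "dim_row M = (\<Sum>i<dim_row M. 1)" by simp
  also have "\<dots> \<le> (\<Sum>i<dim_row M. rat_bits (M $$ (i, 0)))"
    by (intro sum_mono rat_bits_pos)
  also have "\<dots> \<le> mat_bits M"
    unfolding mat_bits_def using False assms
    by (intro sum_mono member_le_sum[where f = "\<lambda>j. rat_bits (M $$ (_, j))"]) auto
  finally show ?thesis .
qed simp

section \<open>Polynomial time\<close>

definition matching_time :: "nat \<Rightarrow> nat" where
  "matching_time n = Suc (n * Suc n) * (11 * n + 21) + 2"

lemma matching_time_mono: "m \<le> n \<Longrightarrow> matching_time m \<le> matching_time n"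
  unfolding matching_time_def by (intro add_mono mult_le_mono Suc_le_mono[THEN iffD2]) auto

definition matching_time_poly :: "nat poly" where
  "matching_time_poly = ([:1:] + [:0, 1:] * [:1, 1:]) * [:21, 11:] + [:2:]"

lemma poly_matching_time_poly: "poly matching_time_poly n = matching_time n"
  by (simp add: matching_time_poly_def matching_time_def algebra_simps)

lemma perfect_input_iff:
  assumes M: "symmetric_mat M" and n: "n = dim_row M"
  shows "perfect n (row_edge n (rmem (input_state M))) \<longleftrightarrow> invertible_signing M"
proof -
  have cell: "rmem (input_state M) (i * n + j) = M $$ (i, j)" if "i < n" "j < n" for i j
  proof -
    have "i * n + j < Suc i * n" using that by simp
    also have "\<dots> \<le> n * n" using that by (intro mult_le_mono1) simp
    finally show ?thesis
      using that by (simp add: input_state_def n[symmetric])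
  qed
  have "(\<forall>i<n. row_edge n (rmem (input_state M)) i (q i)) \<longleftrightarrow> (\<forall>i<n. M $$ (i, q i) \<noteq> 0)"
    if "q permutes {0..<n}" for q
  proof -
    have "q i < n" if "i < n" for i
      using permutes_in_image[OF \<open>q permutes {0..<n}\<close>, of i] that by simp
    then show ?thesis by (simp add: row_edge_def cell)
  qed
  then show ?thesis
    unfolding invertible_signing_iff_permutation[OF M n] perfect_def by blast
qed

text \<open>The summand \<open>rat_bits 0\<close> accounts for the real cells beyond the
  matrix.\<close>

lemma bounded_input_state:
  assumes "square_mat M"
  shows "bounded_state (dim_row M) (mat_bits M + rat_bits 0) (input_state M)"
proof -
  let ?n = "dim_row M"
  have "rat_bits (rmem (input_state M) x) \<le> mat_bits M + rat_bits 0" for x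
  proof (cases "x < ?n * ?n")
    case True
    then have "?n > 0" by (cases ?n) auto
    then have "x div ?n < ?n" "x mod ?n < dim_col M"
      using True assms by (simp_all add: less_mult_imp_div_less)
    then show ?thesis
      using rat_bits_le_mat_bits[of "x div ?n" M "x mod ?n"] True by (simp add: input_state_def Let_def)
  qed (simp add: input_state_def Let_def)
  moreover have "nmem (input_state M) x < 2 ^ ?n" for x
    by (simp add: input_state_def Let_def)
  ultimately show ?thesis by (simp add: bounded_state_def)
qed

lemma integer_matching_prog: "integer_prog matching_prog"
  by (simp add: matching_prog_def bid_step_def scan_def scan_step_def)

theorem theorem3:
  shows "\<exists>c. poly_time_decides c {M :: real mat. symmetric_mat M} invertible_signing"
proof (intro exI[of _ matching_prog])
  let ?c = matching_prog
  have unit: "\<exists>t \<tau>. exec_unit ?c (input_state M) t \<tau> \<and> t \<le> matching_time (dim_row M)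
      \<and> answer \<tau> (invertible_signing M)" if "symmetric_mat M" for M
    using runs_matching_prog[OF refl, of "input_state M" "dim_row M"] perfect_input_iff[OF that refl]
    by (simp add: runs_def matching_time_def input_state_def Let_def)
  define k z where "k = prog_const ?c" and "z = rat_bits 0"
  \<comment> \<open>The bit cost bound with \<open>B = n + k + t\<close>, where \<open>n\<close> is
    replaced by the bit length of the input and \<open>t\<close> by the time bound at that
    length.\<close>
  define p where "p = matching_time_poly *
    ([:8:] * ([:1 + k:] + [:0, 1:] + matching_time_poly) + [:2:] * ([:0, 1:] + [:z:]))"
  have bits: "\<exists>t \<tau>. exec_bits ?c (input_state M) t \<tau> \<and> t \<le> poly p (mat_bits M)
      \<and> answer \<tau> (invertible_signing M)" if M: "symmetric_mat M" for M
  proof -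
    let ?n = "dim_row M" and ?m = "mat_bits M"
    have sq: "square_mat M" using M by (simp add: symmetric_mat_def)
    obtain t \<tau> where t: "exec_unit ?c (input_state M) t \<tau>" "t \<le> matching_time ?n"
      "answer \<tau> (invertible_signing M)"
      using unit[OF M] by blast
    have nm: "?n \<le> ?m" by (rule dim_row_le_mat_bits[OF sq])
    have tm: "t \<le> matching_time ?m"
      using t(2) matching_time_mono[OF nm] by simp
    \<comment> \<open>Adding \<open>k\<close> makes the exponent bound the constants of the program
      too.\<close>
    have "bounded_state (?n + k) (?m + z) (input_state M)"
      using bounded_state_mono[OF bounded_input_state[OF sq]] by (simp add: z_def)
    from exec_bits_of_exec_unit[OF t(1) integer_matching_prog _ this order_refl]
    obtain t' where t': "exec_bits ?c (input_state M) t' \<tau>"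
      "t' \<le> t * (8 * Suc (?n + k + t) + 2 * (?m + z))"
      by (auto simp: k_def)
    note t'(2)
    also have "\<dots> \<le> matching_time ?m * (8 * Suc (?m + k + matching_time ?m) + 2 * (?m + z))"
      using nm tm by (intro mult_le_mono add_mono) auto
    also have "\<dots> = poly p ?m"
      by (simp add: p_def poly_matching_time_poly)
    finally show ?thesis using t'(1) t(3) by blast
  qed
  show "poly_time_decides ?c {M. symmetric_mat M} invertible_signing"
    unfolding poly_time_decides_def
    using unit bits poly_matching_time_poly by (metis (mono_tags, lifting) mem_Collect_eq)
qed

end
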